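(* Let $n\ge 1$ and $N\in\mathbb{C}$. The following relations hold in the Brauer algebra $B(n,N)$, for all $k\in\{1,\dots,n-1\}$ and $l\in\{1,\dots,n\}$: $$s_k x_l=x_l s_k,\qquad \bar s_k x_l=x_l\bar s_k\qquad (l\neq k,k+1);$$ $$s_k x_k-x_{k+1}s_k=\bar s_k-1,\qquad s_k x_{k+1}-x_k s_k=1-\bar s_k;$$ $$\bar s_k(x_k+x_{k+1})=0,\qquad (x_k+x_{k+1})\bar s_k=0.$$
   Context: Brauer algebra. For $n\ge1$ let $\mathcal{G}(n)$ be the set of partitions of $\{1,\dots,n,\bar1,\dots,\bar n\}$ into pairs, viewed as graphs with $2n$ vertices and $n$ edges. For $N\in\mathbb{C}$, $B(n,N)$ is the associative algebra over $\mathbb{C}$ with linear basis $b(\gamma)$, $\gamma\in\mathcal{G}(n)$, and the following product. Identify the vertices $\bar1,\dots,\bar n$ of $\gamma$ with the vertices $1,\dots,n$ of $\gamma'$ respectively; let $q$ be the number of loops (closed cycles) in the resulting graph; remove the loops and replace each remaining connected component by a single edge joining its terminal vertices (unbarred vertices coming from $\gamma$, barred ones from $\gamma'$), obtaining $\gamma\circ\gamma'$. Then $b(\gamma)b(\gamma')=N^{q}\,b(\gamma\circ\gamma')$. A permutation $s\in S(n)$ is identified with $b(\gamma)$ where $\gamma$ has edges $\{s(1),\bar1\},\dots,\{s(n),\bar n\}$. For $k\ne l$, $(k,l)$ is the transposition and $\overline{(k,l)}=b(\gamma)$ where $\gamma$ has edges $\{k,l\}$, $\{\bar k,\bar l\}$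 and $\{m,\bar m\}$ for $m\ne k,l$. Put $s_k=(k,k+1)$, $\bar s_k=\overline{(k,k+1)}$ for $k=1,\dots,n-1$. For $k=1,\dots,n$ put $$x_k=\frac{N-1}{2}+\sum_{l=1}^{k-1}\Bigl((k,l)-\overline{(k,l)}\Bigr).$$ *)

theory Defs
  imports
    Complex_Main
    "HOL-Library.Disjoint_Sets"
    "HOL-Library.Poly_Mapping"
    "HOL-Combinatorics.Permutations"
begin

section \<open>Brauer graphs\<close>

datatype vertex = Pt nat | Bar nat

definition vertices :: "nat \<Rightarrow> vertex set" where
  "vertices n = Pt ` {1..n} \<union> Bar ` {1..n}"

type_synonym graph = "vertex set set"

definition brauer_graphs :: "nat \<Rightarrow> graph set" where
  "brauer_graphs n = {\<gamma>. partition_on (vertices n) \<gamma> \<and> (\<forall>e\<in>\<gamma>. card e = 2)}"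

subsection \<open>Composition\<close>

text \<open>
  Gluing \<open>\<gamma>\<close> on top of \<open>\<gamma>'\<close> identifies the vertex \<open>Bar i\<close> of \<open>\<gamma>\<close> with the vertex \<open>Pt i\<close>
  of \<open>\<gamma>'\<close>; the common vertex is \<open>Middle i\<close>.
\<close>

datatype glued_vertex = Upper nat | Middle nat | Lower nat

fun glue_upper :: "vertex \<Rightarrow> glued_vertex" where
  "glue_upper (Pt i) = Upper i"
| "glue_upper (Bar i) = Middle i"

fun glue_lower :: "vertex \<Rightarrow> glued_vertex" where
  "glue_lower (Pt i) = Middle i"
| "glue_lower (Bar i) = Lower i"

definition upper_edges :: "graph \<Rightarrow> glued_vertex set set" where
  "upper_edges \<gamma> = (\<lambda>e. glue_upper ` e) ` \<gamma>"

definition lower_edges :: "graph \<Rightarrow> glued_vertex set set" where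
  "lower_edges \<gamma>' = (\<lambda>e. glue_lower ` e) ` \<gamma>'"

definition adjacent :: "graph \<Rightarrow> graph \<Rightarrow> (glued_vertex \<times> glued_vertex) set" where
  "adjacent \<gamma> \<gamma>' = {(u, v). {u, v} \<in> upper_edges \<gamma> \<union> lower_edges \<gamma>'}"

definition components :: "graph \<Rightarrow> graph \<Rightarrow> glued_vertex set set" where
  "components \<gamma> \<gamma>' = \<Union> (upper_edges \<gamma> \<union> lower_edges \<gamma>') // (adjacent \<gamma> \<gamma>')\<^sup>*"

text \<open>
  The glued graph is a multigraph: an edge \<open>{Middle i, Middle j}\<close> may come both from \<open>\<gamma>\<close> and
  from \<open>\<gamma>'\<close>, and then it has multiplicity two (and forms a closed cycle). The edges of the two
  graphs are therefore counted separately.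
\<close>

definition glued_degree :: "graph \<Rightarrow> graph \<Rightarrow> glued_vertex \<Rightarrow> nat" where
  "glued_degree \<gamma> \<gamma>' v = card {e \<in> upper_edges \<gamma>. v \<in> e} + card {e \<in> lower_edges \<gamma>'. v \<in> e}"

text \<open>A connected component is a closed cycle when all its vertices have degree two.\<close>

definition loops :: "graph \<Rightarrow> graph \<Rightarrow> glued_vertex set set" where
  "loops \<gamma> \<gamma>' = {C \<in> components \<gamma> \<gamma>'. \<forall>v\<in>C. glued_degree \<gamma> \<gamma>' v = 2}"

definition terminal_vertices :: "glued_vertex set \<Rightarrow> vertex set" where
  "terminal_vertices C = {Pt i | i. Upper i \<in> C} \<union> {Bar i | i. Lower i \<in> C}"

definition compose :: "graph \<Rightarrow> graph \<Rightarrow> graph" where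
  "compose \<gamma> \<gamma>' = terminal_vertices ` (components \<gamma> \<gamma>' - loops \<gamma> \<gamma>')"

section \<open>The Brauer algebra\<close>

text \<open>
  Formal complex linear combinations of graphs. The underlying vector space of \<open>B(n,N)\<close> is
  the subspace \<open>brauer_space n\<close>; addition and subtraction are those of \<^typ>\<open>'a \<Rightarrow>\<^sub>0 complex\<close>.
\<close>

type_synonym brauer = "graph \<Rightarrow>\<^sub>0 complex"

definition brauer_space :: "nat \<Rightarrow> brauer set" where
  "brauer_space n = {a. Poly_Mapping.keys a \<subseteq> brauer_graphs n}"

definition basis :: "graph \<Rightarrow> brauer" where
  "basis \<gamma> = Poly_Mapping.single \<gamma> 1"

definition scale :: "complex \<Rightarrow> brauer \<Rightarrow> brauer" where
  "scale c a = Poly_Mapping.map ((*) c) a"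

text \<open>
  The bilinear extension of \<open>b(\<gamma>) b(\<gamma>') = N\<^sup>q b(\<gamma> \<circ> \<gamma>')\<close>.
\<close>

definition brauer_mult :: "brauer \<Rightarrow> complex \<Rightarrow> brauer \<Rightarrow> brauer"
    ("(_ \<cdot>\<^bsub>_\<^esub> _)" [70, 0, 71] 70) where
  "a \<cdot>\<^bsub>N\<^esub> b =
     (\<Sum>\<gamma>\<in>Poly_Mapping.keys a. \<Sum>\<gamma>'\<in>Poly_Mapping.keys b.
        scale (Poly_Mapping.lookup a \<gamma> * Poly_Mapping.lookup b \<gamma>')
          (scale (N ^ card (loops \<gamma> \<gamma>')) (basis (compose \<gamma> \<gamma>'))))"

definition perm_graph :: "nat \<Rightarrow> (nat \<Rightarrow> nat) \<Rightarrow> graph" where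
  "perm_graph n s = (\<lambda>i. {Pt (s i), Bar i}) ` {1..n}"

definition perm :: "nat \<Rightarrow> (nat \<Rightarrow> nat) \<Rightarrow> brauer" where
  "perm n s = basis (perm_graph n s)"

definition brauer_one :: "nat \<Rightarrow> brauer" where
  "brauer_one n = perm n id"

definition transp :: "nat \<Rightarrow> nat \<Rightarrow> nat \<Rightarrow> brauer" where
  "transp n k l = perm n (Transposition.transpose k l)"

definition bar_transp_graph :: "nat \<Rightarrow> nat \<Rightarrow> nat \<Rightarrow> graph" where
  "bar_transp_graph n k l =
     {{Pt k, Pt l}, {Bar k, Bar l}} \<union> (\<lambda>m. {Pt m, Bar m}) ` ({1..n} - {k, l})"

definition bar_transp :: "nat \<Rightarrow> nat \<Rightarrow> nat \<Rightarrow> brauer" where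
  "bar_transp n k l = basis (bar_transp_graph n k l)"

definition s_gen :: "nat \<Rightarrow> nat \<Rightarrow> brauer" where
  "s_gen n k = transp n k (k + 1)"

definition sbar_gen :: "nat \<Rightarrow> nat \<Rightarrow> brauer" where
  "sbar_gen n k = bar_transp n k (k + 1)"

definition x_elt :: "nat \<Rightarrow> complex \<Rightarrow> nat \<Rightarrow> brauer" where
  "x_elt n N k =
     scale ((N - 1) / 2) (brauer_one n) + (\<Sum>l\<in>{1..<k}. transp n k l - bar_transp n k l)"

section \<open>Basic facts\<close>

lemma lookup_scale: "Poly_Mapping.lookup (scale c a) \<gamma> = c * Poly_Mapping.lookup a \<gamma>"
  by (simp add: scale_def Poly_Mapping.map.rep_eq when_def)

lemma basis_mult:
  "basis \<gamma> \<cdot>\<^bsub>N\<^esub> basis \<gamma>' = scale (N ^ card (loops \<gamma> \<gamma>')) (basis (compose \<gamma> \<gamma>'))"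
proof -
  have "scale 1 a = a" for a
    by (rule poly_mapping_eqI) (simp add: lookup_scale)
  then show ?thesis
    by (simp add: brauer_mult_def basis_def)
qed

lemma perm_graph_in:
  assumes "s permutes {1..n}"
  shows "perm_graph n s \<in> brauer_graphs n"
proof -
  have inj: "s i = s j \<longleftrightarrow> i = j" for i j
    using permutes_inj[OF assms] by (auto simp: inj_def)
  have "Pt ` {1..n} = Pt ` s ` {1..n}"
    using permutes_image[OF assms] by simp
  then have "\<Union> (perm_graph n s) = vertices n"
    unfolding perm_graph_def vertices_def by auto
  moreover have "disjoint (perm_graph n s)"
    by (auto simp: perm_graph_def disjoint_def inj)
  ultimately show ?thesis
    by (auto simp: brauer_graphs_def partition_on_def perm_graph_def)
qed

lemma bar_transp_graph_in:
  assumes "k \<in> {1..n}" "l \<in> {1..n}" "k \<noteq> l"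
  shows "bar_transp_graph n k l \<in> brauer_graphs n"
proof -
  have "\<Union> (bar_transp_graph n k l) = vertices n"
    using assms unfolding bar_transp_graph_def vertices_def by auto
  moreover have "disjoint (bar_transp_graph n k l)"
    by (auto simp: bar_transp_graph_def disjoint_def)
  ultimately show ?thesis
    using assms by (auto simp: brauer_graphs_def partition_on_def bar_transp_graph_def)
qed

lemma brauer_space_basis: "\<gamma> \<in> brauer_graphs n \<Longrightarrow> basis \<gamma> \<in> brauer_space n"
  by (simp add: brauer_space_def basis_def)

lemma brauer_space_zero: "0 \<in> brauer_space n"
  by (simp add: brauer_space_def)

lemma brauer_space_add: "a \<in> brauer_space n \<Longrightarrow> b \<in> brauer_space n \<Longrightarrow> a + b \<in> brauer_space n"
  using Poly_Mapping.keys_add[of a b] by (auto simp: brauer_space_def)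

lemma brauer_space_diff: "a \<in> brauer_space n \<Longrightarrow> b \<in> brauer_space n \<Longrightarrow> a - b \<in> brauer_space n"
  using Poly_Mapping.keys_diff[of a b] by (auto simp: brauer_space_def)

lemma brauer_space_scale: "a \<in> brauer_space n \<Longrightarrow> scale c a \<in> brauer_space n"
  by (auto simp: brauer_space_def in_keys_iff lookup_scale subset_iff)

lemma brauer_space_sum: "(\<And>i. i \<in> I \<Longrightarrow> f i \<in> brauer_space n) \<Longrightarrow> sum f I \<in> brauer_space n"
  by (induction I rule: infinite_finite_induct) (auto simp: brauer_space_zero brauer_space_add)

lemma perm_in: "s permutes {1..n} \<Longrightarrow> perm n s \<in> brauer_space n"
  by (simp add: perm_def brauer_space_basis perm_graph_in)

lemma transp_in: "k \<in> {1..n} \<Longrightarrow> l \<in> {1..n} \<Longrightarrow> transp n k l \<in> brauer_space n"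
  by (simp add: transp_def perm_in permutes_swap_id)

lemma bar_transp_in:
  "k \<in> {1..n} \<Longrightarrow> l \<in> {1..n} \<Longrightarrow> k \<noteq> l \<Longrightarrow> bar_transp n k l \<in> brauer_space n"
  by (simp add: bar_transp_def brauer_space_basis bar_transp_graph_in)

lemma x_elt_in:
  assumes "k \<in> {1..n}"
  shows "x_elt n N k \<in> brauer_space n"
  unfolding x_elt_def
proof (intro brauer_space_add brauer_space_scale brauer_space_sum brauer_space_diff)
  show "brauer_one n \<in> brauer_space n"
    unfolding brauer_one_def by (intro perm_in permutes_id)
qed (use assms in \<open>auto intro!: transp_in bar_transp_in\<close>)

end

theory Submission
  imports Defs
begin

text \<open>
  Write \<open>t(i,j)\<close> for the transposition and \<open>e(i,j)\<close> for the element \<^const>\<open>bar_transp\<close> with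
  edges \<open>{i,j}\<close> above and below, and let \<open>d(i,j) = t(i,j) - e(i,j)\<close>, so that \<open>x\<^sub>k\<close> is a
  scalar plus the sum of the \<open>d(k,l)\<close> with \<open>l < k\<close>. All the relations follow from five facts
  about products of graphs:

  \<^item> \<open>s d(i,j) = d(s i, s j) s\<close> for every permutation \<open>s\<close> (\<open>perm_jm_term_conj\<close>);
  \<^item> \<open>e(i,j)\<close> commutes with \<open>d(k,l)\<close> when \<open>i, j, k, l\<close> are distinct
    (\<open>bar_transp_jm_term_commute\<close>);
  \<^item> \<open>e(i,j) e(i,j) = N e(i,j)\<close> (\<open>bar_transp_square\<close>);
  \<^item> \<open>e(i,j) t(i,j) = t(i,j) e(i,j) = e(i,j)\<close> (\<open>bar_transp_mult_transp_self\<close>,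
    \<open>transp_mult_bar_transp_self\<close>);
  \<^item> for distinct \<open>i, j, l\<close>, \<open>e(i,j) e(j,l) = e(i,j) t(i,l)\<close> and
    \<open>e(j,l) e(i,j) = t(i,l) e(i,j)\<close> (\<open>bar_transp_mult_overlap\<close> and its mirror image).

  Because \<open>e(i,j) = e(j,i)\<close>, the last fact shows that \<open>d(i,l) + d(j,l)\<close> is annihilated by
  \<open>e(i,j)\<close> on both sides. Hence in \<open>e(k,k+1) (x\<^sub>k + x\<^bsub>k+1\<^esub>)\<close> only the scalar \<open>N - 1\<close> and
  the summand \<open>d(k,k+1)\<close> survive; the latter contributes \<open>1 - N\<close>. In the same way all
  summands of \<open>x\<^sub>l\<close> commute with \<open>e(k,k+1)\<close>, except possibly \<open>d(l,k)\<close> and \<open>d(l,k+1)\<close>, which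
  occur together and whose sum is annihilated. The relations for \<open>s\<^sub>k\<close> are conjugation of the sum
  defining \<open>x\<^sub>l\<close>; when \<open>x\<^bsub>k+1\<^esub>\<close> occurs, its summand \<open>d(k+1,k)\<close> is left over and gives
  \<open>d(k+1,k) s\<^sub>k = 1 - e(k,k+1)\<close>.

  The products of graphs reduce to two general rules. Multiplication by a permutation relabels
  the vertices on one side (\<open>perm_mult_basis\<close>, \<open>basis_mult_perm\<close>); multiplication by
  \<open>e(i,j)\<close> from the left joins the edges at \<open>i\<close> and \<open>j\<close> (\<open>bar_transp_mult\<close>). Both are
  proved by exhibiting the partition of the glued vertices into connected components
  (\<open>basis_mult_eqI\<close>).
\<close>

section \<open>Connected components of a glued graph\<close>

lemma brauer_graphs_Union: "\<gamma> \<in> brauer_graphs n \<Longrightarrow> \<Union> \<gamma> = vertices n"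
  by (simp add: brauer_graphs_def partition_on_def)

lemma brauer_graphs_unique_edge:
  assumes "\<gamma> \<in> brauer_graphs n" "e \<in> \<gamma>" "f \<in> \<gamma>" "v \<in> e" "v \<in> f"
  shows "e = f"
proof -
  have "disjoint \<gamma>"
    using assms(1) by (simp add: brauer_graphs_def partition_on_def)
  then show ?thesis
    using assms(2-5) unfolding disjoint_def by blast
qed

lemma brauer_graphs_edge:
  assumes "\<gamma> \<in> brauer_graphs n" "e \<in> \<gamma>"
  obtains u v where "e = {u, v}" "u \<noteq> v" "u \<in> vertices n" "v \<in> vertices n"
proof -
  from assms have "card e = 2" "e \<subseteq> vertices n"
    using brauer_graphs_Union[of \<gamma> n] by (auto simp: brauer_graphs_def)
  then show ?thesis
    using that by (auto simp: card_2_iff)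
qed

lemma brauer_graphs_nonempty: "\<gamma> \<in> brauer_graphs n \<Longrightarrow> e \<in> \<gamma> \<Longrightarrow> e \<noteq> {}"
  by (auto simp: brauer_graphs_def partition_on_def)

lemma Pt_in_vertices [simp]: "Pt i \<in> vertices n \<longleftrightarrow> i \<in> {1..n}"
  and Bar_in_vertices [simp]: "Bar i \<in> vertices n \<longleftrightarrow> i \<in> {1..n}"
  by (auto simp: vertices_def)

lemma brauer_graphs_edges_at:
  assumes "\<gamma> \<in> brauer_graphs n" "v \<in> vertices n"
  obtains e where "{f \<in> \<gamma>. v \<in> f} = {e}"
proof -
  from assms obtain e where "e \<in> \<gamma>" "v \<in> e"
    using brauer_graphs_Union[of \<gamma> n] by blast
  then show ?thesis
    using that[of e] brauer_graphs_unique_edge[OF assms(1)] by blast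
qed

text \<open>The vertices of a glued graph.\<close>

definition glued_vertices :: "nat \<Rightarrow> glued_vertex set" where
  "glued_vertices n = Upper ` {1..n} \<union> Middle ` {1..n} \<union> Lower ` {1..n}"

lemma in_glued_vertices [simp]:
  "Upper i \<in> glued_vertices n \<longleftrightarrow> i \<in> {1..n}"
  "Middle i \<in> glued_vertices n \<longleftrightarrow> i \<in> {1..n}"
  "Lower i \<in> glued_vertices n \<longleftrightarrow> i \<in> {1..n}"
  by (auto simp: glued_vertices_def)

lemma inj_glue_upper: "inj glue_upper"
  by (rule injI, rename_tac x y, case_tac x; case_tac y; simp)

lemma inj_glue_lower: "inj glue_lower"
  by (rule injI, rename_tac x y, case_tac x; case_tac y; simp)

lemma Union_upper_edges:
  assumes "\<gamma> \<in> brauer_graphs n"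
  shows "\<Union> (upper_edges \<gamma>) = Upper ` {1..n} \<union> Middle ` {1..n}"
proof -
  have "\<Union> (upper_edges \<gamma>) = glue_upper ` \<Union> \<gamma>"
    by (auto simp: upper_edges_def)
  then show ?thesis
    by (simp add: brauer_graphs_Union[OF assms] vertices_def image_Un image_image)
qed

lemma Union_lower_edges:
  assumes "\<gamma> \<in> brauer_graphs n"
  shows "\<Union> (lower_edges \<gamma>) = Middle ` {1..n} \<union> Lower ` {1..n}"
proof -
  have "\<Union> (lower_edges \<gamma>) = glue_lower ` \<Union> \<gamma>"
    by (auto simp: lower_edges_def)
  then show ?thesis
    by (simp add: brauer_graphs_Union[OF assms] vertices_def image_Un image_image)
qed

lemma Union_glued_edges:
  assumes "\<gamma> \<in> brauer_graphs n" "\<gamma>' \<in> brauer_graphs n"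
  shows "\<Union> (upper_edges \<gamma> \<union> lower_edges \<gamma>') = glued_vertices n"
  using Union_upper_edges[OF assms(1)] Union_lower_edges[OF assms(2)]
  by (auto simp: glued_vertices_def)

lemma adjacent_rtrancl_sym:
  assumes "(u, v) \<in> (adjacent \<gamma> \<gamma>')\<^sup>*"
  shows "(v, u) \<in> (adjacent \<gamma> \<gamma>')\<^sup>*"
proof -
  have "sym (adjacent \<gamma> \<gamma>')"
    by (auto simp: sym_def adjacent_def insert_commute)
  then show ?thesis
    using assms by (metis sym_rtrancl symD)
qed

text \<open>
  A partition of the glued vertices is the partition into components as soon as no edge leaves
  a block and every block has a root to which all its vertices are connected.
\<close>

lemma components_eqI:
  assumes cover: "\<Union> P = \<Union> (upper_edges \<gamma> \<union> lower_edges \<gamma>')"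
    and disj: "\<And>C D v. C \<in> P \<Longrightarrow> D \<in> P \<Longrightarrow> v \<in> C \<Longrightarrow> v \<in> D \<Longrightarrow> C = D"
    and nonempty: "{} \<notin> P"
    and edges: "\<And>f. f \<in> upper_edges \<gamma> \<union> lower_edges \<gamma>' \<Longrightarrow> \<exists>C\<in>P. f \<subseteq> C"
    and conn: "\<And>C. C \<in> P \<Longrightarrow> \<exists>r. \<forall>v\<in>C. (v, r) \<in> (adjacent \<gamma> \<gamma>')\<^sup>*"
  shows "components \<gamma> \<gamma>' = P"
proof -
  have cls: "(adjacent \<gamma> \<gamma>')\<^sup>* `` {x} = C" if C: "C \<in> P" "x \<in> C" for x C
  proof
    show "(adjacent \<gamma> \<gamma>')\<^sup>* `` {x} \<subseteq> C"
    proof clarify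
      fix y assume "(x, y) \<in> (adjacent \<gamma> \<gamma>')\<^sup>*"
      then show "y \<in> C"
      proof induction
        case base
        show ?case using C by simp
      next
        case (step y z)
        then obtain D where "D \<in> P" "{y, z} \<subseteq> D"
          using edges[of "{y, z}"] by (auto simp: adjacent_def)
        then show ?case
          using disj[of C D y] C step by auto
      qed
    qed
    show "C \<subseteq> (adjacent \<gamma> \<gamma>')\<^sup>* `` {x}"
      using conn[OF C(1)] C(2) by (auto intro: rtrancl_trans adjacent_rtrancl_sym)
  qed
  show ?thesis
  proof
    show "components \<gamma> \<gamma>' \<subseteq> P"
      unfolding components_def cover[symmetric] quotient_def using cls by auto
    show "P \<subseteq> components \<gamma> \<gamma>'"
    proof
      fix C assume C: "C \<in> P"
      with nonempty obtain x where "x \<in> C" by fastforce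
      with C show "C \<in> components \<gamma> \<gamma>'"
        using cls[OF C, of x] unfolding components_def cover[symmetric]
        by (metis UnionI quotientI)
    qed
  qed
qed

text \<open>
  Exactly the middle vertices have degree two, so the closed cycles are the components that
  contain no terminal vertex.
\<close>

lemma loops_eq:
  assumes g: "\<gamma> \<in> brauer_graphs n" and g': "\<gamma>' \<in> brauer_graphs n"
    and sub: "\<Union> (components \<gamma> \<gamma>') \<subseteq> glued_vertices n"
  shows "loops \<gamma> \<gamma>' = {C \<in> components \<gamma> \<gamma>'. terminal_vertices C = {}}"
proof -
  have up: "card {e \<in> upper_edges \<gamma>. glue_upper v \<in> e} = 1" if v: "v \<in> vertices n" for v
  proof -
    obtain e where "{f \<in> \<gamma>. v \<in> f} = {e}"
      using brauer_graphs_edges_at[OF g v] .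
    moreover have "{e \<in> upper_edges \<gamma>. glue_upper v \<in> e} = (`) glue_upper ` {f \<in> \<gamma>. v \<in> f}"
      unfolding upper_edges_def using inj_image_mem_iff[OF inj_glue_upper] by blast
    ultimately show ?thesis by simp
  qed
  have low: "card {e \<in> lower_edges \<gamma>'. glue_lower v \<in> e} = 1" if v: "v \<in> vertices n" for v
  proof -
    obtain e where "{f \<in> \<gamma>'. v \<in> f} = {e}"
      using brauer_graphs_edges_at[OF g' v] .
    moreover have "{e \<in> lower_edges \<gamma>'. glue_lower v \<in> e} = (`) glue_lower ` {f \<in> \<gamma>'. v \<in> f}"
      unfolding lower_edges_def using inj_image_mem_iff[OF inj_glue_lower] by blast
    ultimately show ?thesis by simp
  qed
  have "{e \<in> lower_edges \<gamma>'. Upper i \<in> e} = {}" "{e \<in> upper_edges \<gamma>. Lower i \<in> e} = {}" for i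
    using Union_lower_edges[OF g'] Union_upper_edges[OF g] by blast+
  then have none: "card {e \<in> lower_edges \<gamma>'. Upper i \<in> e} = 0"
      "card {e \<in> upper_edges \<gamma>. Lower i \<in> e} = 0" for i
    by (metis card.empty)+
  have deg: "glued_degree \<gamma> \<gamma>' (Upper i) = 1" "glued_degree \<gamma> \<gamma>' (Middle i) = 2"
      "glued_degree \<gamma> \<gamma>' (Lower i) = 1" if "i \<in> {1..n}" for i
    using up[of "Pt i"] up[of "Bar i"] low[of "Pt i"] low[of "Bar i"] that none[of i]
    by (simp_all add: glued_degree_def del: One_nat_def)
  have "(\<forall>v\<in>C. glued_degree \<gamma> \<gamma>' v = 2) \<longleftrightarrow> terminal_vertices C = {}"
    if C: "C \<in> components \<gamma> \<gamma>'" for C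
  proof -
    from C sub have subC: "C \<subseteq> glued_vertices n" by blast
    have "glued_degree \<gamma> \<gamma>' v = 2 \<longleftrightarrow> (\<exists>i. v = Middle i)" if "v \<in> C" for v
      using that subC deg by (cases v) auto
    then have "(\<forall>v\<in>C. glued_degree \<gamma> \<gamma>' v = 2) \<longleftrightarrow> (\<forall>v\<in>C. \<exists>i. v = Middle i)"
      by simp
    also have "\<dots> \<longleftrightarrow> terminal_vertices C = {}"
      by (auto simp: terminal_vertices_def) (metis glued_vertex.exhaust)
    finally show ?thesis .
  qed
  then show ?thesis
    by (auto simp: loops_def)
qed

text \<open>The product of two graphs can be read off from a partition \<open>P\<close> as in \<open>components_eqI\<close>.\<close>

lemma basis_mult_eqI:
  assumes g: "\<gamma> \<in> brauer_graphs n" and g': "\<gamma>' \<in> brauer_graphs n"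
    and cover: "\<Union> P = glued_vertices n"
    and disj: "\<And>C D v. C \<in> P \<Longrightarrow> D \<in> P \<Longrightarrow> v \<in> C \<Longrightarrow> v \<in> D \<Longrightarrow> C = D"
    and nonempty: "{} \<notin> P"
    and upper: "\<And>e. e \<in> \<gamma> \<Longrightarrow> \<exists>C\<in>P. glue_upper ` e \<subseteq> C"
    and lower: "\<And>e. e \<in> \<gamma>' \<Longrightarrow> \<exists>C\<in>P. glue_lower ` e \<subseteq> C"
    and conn: "\<And>C. C \<in> P \<Longrightarrow> \<exists>r. \<forall>v\<in>C. (v, r) \<in> (adjacent \<gamma> \<gamma>')\<^sup>*"
  shows "basis \<gamma> \<cdot>\<^bsub>N\<^esub> basis \<gamma>' =
    scale (N ^ card {C \<in> P. terminal_vertices C = {}})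
      (basis (terminal_vertices ` {C \<in> P. terminal_vertices C \<noteq> {}}))"
proof -
  have comp: "components \<gamma> \<gamma>' = P"
    using Union_glued_edges[OF g g'] cover disj nonempty upper lower conn
    by (intro components_eqI) (auto simp: upper_edges_def lower_edges_def)
  have loops: "loops \<gamma> \<gamma>' = {C \<in> P. terminal_vertices C = {}}"
    using loops_eq[OF g g'] cover by (simp add: comp)
  have "compose \<gamma> \<gamma>' = terminal_vertices ` {C \<in> P. terminal_vertices C \<noteq> {}}"
    unfolding compose_def comp loops by (rule arg_cong[where f = "(`) _"]) auto
  then show ?thesis
    by (simp add: basis_mult loops)
qed

lemma scale_one [simp]: "scale 1 a = a"
  by (rule poly_mapping_eqI) (simp add: lookup_scale)

text \<open>
  If the glued graph contains a copy \<open>h ` e\<close> of every edge \<open>e\<close> of a Brauer graph \<open>\<delta>\<close>, and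
  every vertex \<open>v\<close> is connected to the vertex \<open>h (c v)\<close> of that copy, then the components are
  the sets of vertices that \<open>c\<close> collapses into an edge of \<open>\<delta>\<close>. When the terminal vertices of
  such a component form the image of that edge under \<open>\<phi>\<close>, no closed cycle arises and the
  product is the graph \<open>\<delta>\<close> relabelled by \<open>\<phi>\<close>.
\<close>

lemma basis_mult_collapse:
  assumes g: "\<gamma> \<in> brauer_graphs n" and g': "\<gamma>' \<in> brauer_graphs n" and d: "\<delta> \<in> brauer_graphs n"
    and c: "\<And>v. v \<in> glued_vertices n \<Longrightarrow> c v \<in> vertices n"
    and h: "\<And>v. v \<in> vertices n \<Longrightarrow> h v \<in> glued_vertices n"
    and ch: "\<And>v. v \<in> vertices n \<Longrightarrow> c (h v) = v"
    and upper: "\<And>e. e \<in> \<gamma> \<Longrightarrow> \<exists>f\<in>\<delta>. c ` glue_upper ` e \<subseteq> f"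
    and lower: "\<And>e. e \<in> \<gamma>' \<Longrightarrow> \<exists>f\<in>\<delta>. c ` glue_lower ` e \<subseteq> f"
    and hedge: "\<And>u v. {u, v} \<in> \<delta> \<Longrightarrow> (h u, h v) \<in> adjacent \<gamma> \<gamma>'"
    and attach: "\<And>v. v \<in> glued_vertices n \<Longrightarrow> (v, h (c v)) \<in> (adjacent \<gamma> \<gamma>')\<^sup>*"
    and terminals: "\<And>e. e \<in> \<delta> \<Longrightarrow> terminal_vertices {v \<in> glued_vertices n. c v \<in> e} = \<phi> ` e"
  shows "basis \<gamma> \<cdot>\<^bsub>N\<^esub> basis \<gamma>' = basis ((`) \<phi> ` \<delta>)"
proof -
  define pre where "pre e = {v \<in> glued_vertices n. c v \<in> e}" for e
  define P where "P = pre ` \<delta>"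
  have Ud: "\<Union> \<delta> = vertices n" by (rule brauer_graphs_Union[OF d])
  have "basis \<gamma> \<cdot>\<^bsub>N\<^esub> basis \<gamma>' =
    scale (N ^ card {C \<in> P. terminal_vertices C = {}})
      (basis (terminal_vertices ` {C \<in> P. terminal_vertices C \<noteq> {}}))"
  proof (rule basis_mult_eqI[OF g g'])
    show "\<Union> P = glued_vertices n"
      using c Ud by (fastforce simp: P_def pre_def)
    show "C = D" if "C \<in> P" "D \<in> P" "v \<in> C" "v \<in> D" for C D v
      using that brauer_graphs_unique_edge[OF d, of _ _ "c v"]
      unfolding P_def pre_def by blast
    show "{} \<notin> P"
    proof
      assume "{} \<in> P"
      then obtain e where "e \<in> \<delta>" "pre e = {}" by (auto simp: P_def)
      moreover from this obtain v where "v \<in> e" "v \<in> vertices n"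
        using brauer_graphs_nonempty[OF d] Ud by blast
      ultimately show False
        using h[of v] ch[of v] by (auto simp: pre_def)
    qed
    show "\<exists>C\<in>P. glue_upper ` e \<subseteq> C" if e: "e \<in> \<gamma>" for e
    proof -
      obtain f where f: "f \<in> \<delta>" "c ` glue_upper ` e \<subseteq> f" using upper[OF e] by blast
      moreover have "glue_upper ` e \<subseteq> glued_vertices n"
        using Union_glued_edges[OF g g'] e by (auto simp: upper_edges_def)
      ultimately show ?thesis by (auto simp: P_def pre_def)
    qed
    show "\<exists>C\<in>P. glue_lower ` e \<subseteq> C" if e: "e \<in> \<gamma>'" for e
    proof -
      obtain f where f: "f \<in> \<delta>" "c ` glue_lower ` e \<subseteq> f" using lower[OF e] by blast
      moreover have "glue_lower ` e \<subseteq> glued_vertices n"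
        using Union_glued_edges[OF g g'] e by (auto simp: lower_edges_def)
      ultimately show ?thesis by (auto simp: P_def pre_def)
    qed
    show "\<exists>r. \<forall>v\<in>C. (v, r) \<in> (adjacent \<gamma> \<gamma>')\<^sup>*" if C: "C \<in> P" for C
    proof -
      from C obtain e where e: "e \<in> \<delta>" "C = pre e" by (auto simp: P_def)
      then obtain u w where uw: "e = {u, w}" by (blast elim: brauer_graphs_edge[OF d])
      have "(h w, h u) \<in> adjacent \<gamma> \<gamma>'"
        using hedge[of w u] e uw by (simp add: insert_commute)
      then have "(v, h u) \<in> (adjacent \<gamma> \<gamma>')\<^sup>*" if "v \<in> C" for v
        using that attach[of v] e uw by (auto simp: pre_def intro: rtrancl_into_rtrancl)
      then show ?thesis by blast
    qed
  qed
  also have "{C \<in> P. terminal_vertices C = {}} = {}"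
    using terminals brauer_graphs_nonempty[OF d] by (auto simp: P_def pre_def)
  also have "{C \<in> P. terminal_vertices C \<noteq> {}} = P"
    using terminals brauer_graphs_nonempty[OF d] by (auto simp: P_def pre_def)
  also have "terminal_vertices ` P = (`) \<phi> ` \<delta>"
    using terminals by (auto simp: P_def pre_def image_image)
  finally show ?thesis by simp
qed

section \<open>Products of basis elements\<close>

text \<open>Relabelling of the unbarred vertices by \<open>f\<close> and of the barred ones by \<open>g\<close>.\<close>

fun relabel :: "(nat \<Rightarrow> nat) \<Rightarrow> (nat \<Rightarrow> nat) \<Rightarrow> vertex \<Rightarrow> vertex" where
  "relabel f g (Pt i) = Pt (f i)"
| "relabel f g (Bar i) = Bar (g i)"

lemma perm_mult_basis:
  assumes s: "s permutes {1..n}" and g: "\<gamma> \<in> brauer_graphs n"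
  shows "perm n s \<cdot>\<^bsub>N\<^esub> basis \<gamma> = basis ((`) (relabel s id) ` \<gamma>)"
proof -
  \<comment> \<open>Each edge \<open>{Upper (s i), Middle i}\<close> of the permutation is contracted into its lower end.\<close>
  define c where "c v = (case v of Upper i \<Rightarrow> Pt (inv s i) | Middle i \<Rightarrow> Pt i | Lower i \<Rightarrow> Bar i)" for v
  have inv_in: "inv s i \<in> {1..n} \<longleftrightarrow> i \<in> {1..n}" for i
    using permutes_in_image[OF permutes_inv[OF s]] .
  have inv: "inv s (s i) = i" "s (inv s i) = i" for i
    using permutes_inverses[OF s] by auto
  have cl: "c (glue_lower v) = v" for v
    by (cases v) (auto simp: c_def)
  show ?thesis
    unfolding perm_def
  proof (rule basis_mult_collapse[where c = c and h = glue_lower and n = n,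
        OF perm_graph_in[OF s] g g])
    show "c v \<in> vertices n" if "v \<in> glued_vertices n" for v
      using that inv_in by (cases v) (auto simp: c_def simp del: atLeastAtMost_iff)
    show "glue_lower v \<in> glued_vertices n" if "v \<in> vertices n" for v
      using that by (cases v) auto
    show "c (glue_lower v) = v" for v by (rule cl)
    show "\<exists>f\<in>\<gamma>. c ` glue_upper ` e \<subseteq> f" if e: "e \<in> perm_graph n s" for e
    proof -
      from e obtain i where i: "i \<in> {1..n}" "e = {Pt (s i), Bar i}"
        by (auto simp: perm_graph_def)
      then obtain f where "f \<in> \<gamma>" "Pt i \<in> f"
        using brauer_graphs_Union[OF g] by (metis Pt_in_vertices UnionE)
      then show ?thesis using i by (auto simp: c_def inv)
    qed
    show "\<exists>f\<in>\<gamma>. c ` glue_lower ` e \<subseteq> f" if e: "e \<in> \<gamma>" for e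
      using e by (auto simp: cl image_image)
    show "(glue_lower u, glue_lower v) \<in> adjacent (perm_graph n s) \<gamma>" if "{u, v} \<in> \<gamma>" for u v
      using imageI[OF that, of "\<lambda>e. glue_lower ` e"] by (simp add: adjacent_def lower_edges_def)
    show "(v, glue_lower (c v)) \<in> (adjacent (perm_graph n s) \<gamma>)\<^sup>*"
      if v: "v \<in> glued_vertices n" for v
    proof (cases v)
      case (Upper i)
      then have "inv s i \<in> {1..n}" using v inv_in by simp
      then have "{Pt (s (inv s i)), Bar (inv s i)} \<in> perm_graph n s"
        unfolding perm_graph_def by blast
      then have "glue_upper ` {Pt i, Bar (inv s i)} \<in> upper_edges (perm_graph n s)"
        unfolding inv upper_edges_def by (rule imageI)
      then show ?thesis
        using Upper by (auto simp: c_def adjacent_def)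
    qed (auto simp: c_def)
    show "terminal_vertices {v \<in> glued_vertices n. c v \<in> e} = relabel s id ` e" if e: "e \<in> \<gamma>" for e
    proof -
      have sub: "e \<subseteq> vertices n" using e brauer_graphs_Union[OF g] by blast
      show ?thesis
      proof (rule set_eqI)
        fix v
        show "v \<in> terminal_vertices {v \<in> glued_vertices n. c v \<in> e} \<longleftrightarrow> v \<in> relabel s id ` e"
        proof (cases v)
          case (Pt i)
          have "v \<in> terminal_vertices {v \<in> glued_vertices n. c v \<in> e} \<longleftrightarrow> Pt (inv s i) \<in> e"
            using sub inv_in[of i] Pt by (auto simp: terminal_vertices_def c_def)
          also have "\<dots> \<longleftrightarrow> v \<in> relabel s id ` e"
          proof
            assume "Pt (inv s i) \<in> e"
            then have "relabel s id (Pt (inv s i)) \<in> relabel s id ` e" by (rule imageI)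
            then show "v \<in> relabel s id ` e" by (simp add: inv Pt)
          next
            assume "v \<in> relabel s id ` e"
            then obtain w where "w \<in> e" "relabel s id w = Pt i" using Pt by auto
            then show "Pt (inv s i) \<in> e" by (cases w) (auto simp: inv)
          qed
          finally show ?thesis .
        next
          case (Bar i)
          have "v \<in> terminal_vertices {v \<in> glued_vertices n. c v \<in> e} \<longleftrightarrow> Bar i \<in> e"
            using sub Bar by (auto simp: terminal_vertices_def c_def)
          also have "\<dots> \<longleftrightarrow> v \<in> relabel s id ` e"
          proof
            assume "Bar i \<in> e"
            then have "relabel s id (Bar i) \<in> relabel s id ` e" by (rule imageI)
            then show "v \<in> relabel s id ` e" by (simp add: Bar)
          next
            assume "v \<in> relabel s id ` e"
            then obtain w where "w \<in> e" "relabel s id w = Bar i" using Bar by auto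
            then show "Bar i \<in> e" by (cases w) auto
          qed
          finally show ?thesis .
        qed
      qed
    qed
  qed
qed


lemma basis_mult_perm:
  assumes s: "s permutes {1..n}" and g: "\<gamma> \<in> brauer_graphs n"
  shows "basis \<gamma> \<cdot>\<^bsub>N\<^esub> perm n s = basis ((`) (relabel id (inv s)) ` \<gamma>)"
proof -
  \<comment> \<open>Each edge \<open>{Middle (s i), Lower i}\<close> of the permutation is contracted into its upper end.\<close>
  define c where "c v = (case v of Upper i \<Rightarrow> Pt i | Middle i \<Rightarrow> Bar i | Lower i \<Rightarrow> Bar (s i))" for v
  have s_in: "s i \<in> {1..n} \<longleftrightarrow> i \<in> {1..n}" for i
    using permutes_in_image[OF s] .
  have inv: "inv s (s i) = i" "s (inv s i) = i" for i
    using permutes_inverses[OF s] by auto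
  have cu: "c (glue_upper v) = v" for v
    by (cases v) (auto simp: c_def)
  show ?thesis
    unfolding perm_def
  proof (rule basis_mult_collapse[where c = c and h = glue_upper and n = n,
        OF g perm_graph_in[OF s] g])
    show "c v \<in> vertices n" if "v \<in> glued_vertices n" for v
      using that s_in by (cases v) (auto simp: c_def simp del: atLeastAtMost_iff)
    show "glue_upper v \<in> glued_vertices n" if "v \<in> vertices n" for v
      using that by (cases v) auto
    show "c (glue_upper v) = v" for v by (rule cu)
    show "\<exists>f\<in>\<gamma>. c ` glue_lower ` e \<subseteq> f" if e: "e \<in> perm_graph n s" for e
    proof -
      from e obtain i where i: "i \<in> {1..n}" "e = {Pt (s i), Bar i}"
        by (auto simp: perm_graph_def)
      then obtain f where "f \<in> \<gamma>" "Bar (s i) \<in> f"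
        using brauer_graphs_Union[OF g] s_in by (metis Bar_in_vertices UnionE)
      then show ?thesis using i by (auto simp: c_def)
    qed
    show "\<exists>f\<in>\<gamma>. c ` glue_upper ` e \<subseteq> f" if e: "e \<in> \<gamma>" for e
      using e by (auto simp: cu image_image)
    show "(glue_upper u, glue_upper v) \<in> adjacent \<gamma> (perm_graph n s)" if "{u, v} \<in> \<gamma>" for u v
      using imageI[OF that, of "\<lambda>e. glue_upper ` e"] by (simp add: adjacent_def upper_edges_def)
    show "(v, glue_upper (c v)) \<in> (adjacent \<gamma> (perm_graph n s))\<^sup>*"
      if v: "v \<in> glued_vertices n" for v
    proof (cases v)
      case (Lower i)
      then have "{Pt (s i), Bar i} \<in> perm_graph n s"
        using v unfolding perm_graph_def by auto
      then have "glue_lower ` {Pt (s i), Bar i} \<in> lower_edges (perm_graph n s)"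
        unfolding lower_edges_def by (rule imageI)
      then show ?thesis
        using Lower by (auto simp: c_def adjacent_def insert_commute)
    qed (auto simp: c_def)
    show "terminal_vertices {v \<in> glued_vertices n. c v \<in> e} = relabel id (inv s) ` e"
      if e: "e \<in> \<gamma>" for e
    proof -
      have sub: "e \<subseteq> vertices n" using e brauer_graphs_Union[OF g] by blast
      show ?thesis
      proof (rule set_eqI)
        fix v
        show "v \<in> terminal_vertices {v \<in> glued_vertices n. c v \<in> e}
          \<longleftrightarrow> v \<in> relabel id (inv s) ` e"
        proof (cases v)
          case (Bar i)
          have "v \<in> terminal_vertices {v \<in> glued_vertices n. c v \<in> e} \<longleftrightarrow> Bar (s i) \<in> e"
            using sub s_in[of i] Bar by (auto simp: terminal_vertices_def c_def)
          also have "\<dots> \<longleftrightarrow> v \<in> relabel id (inv s) ` e"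
          proof
            assume "Bar (s i) \<in> e"
            then have "relabel id (inv s) (Bar (s i)) \<in> relabel id (inv s) ` e" by (rule imageI)
            then show "v \<in> relabel id (inv s) ` e" by (simp add: inv Bar)
          next
            assume "v \<in> relabel id (inv s) ` e"
            then obtain w where "w \<in> e" "relabel id (inv s) w = Bar i" using Bar by auto
            then show "Bar (s i) \<in> e" by (cases w) (auto simp: inv)
          qed
          finally show ?thesis .
        next
          case (Pt i)
          have "v \<in> terminal_vertices {v \<in> glued_vertices n. c v \<in> e} \<longleftrightarrow> Pt i \<in> e"
            using sub Pt by (auto simp: terminal_vertices_def c_def)
          also have "\<dots> \<longleftrightarrow> v \<in> relabel id (inv s) ` e"
          proof
            assume "Pt i \<in> e"
            then have "relabel id (inv s) (Pt i) \<in> relabel id (inv s) ` e" by (rule imageI)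
            then show "v \<in> relabel id (inv s) ` e" by (simp add: Pt)
          next
            assume "v \<in> relabel id (inv s) ` e"
            then obtain w where "w \<in> e" "relabel id (inv s) w = Pt i" using Pt by auto
            then show "Pt i \<in> e" by (cases w) auto
          qed
          finally show ?thesis .
        qed
      qed
    qed
  qed
qed

text \<open>
  Multiplication by \<open>e(i,j)\<close> from the left: the edges \<open>A\<close> and \<open>B\<close> of \<open>\<gamma>\<close> at \<open>Pt i\<close> and
  \<open>Pt j\<close> are joined by the lower edge of \<open>e(i,j)\<close> into one component, whose set of terminal
  vertices is \<open>R\<close>; it is a closed cycle if \<open>A = B\<close>, that is, if \<open>R\<close> is empty. The upper edge
  of \<open>e(i,j)\<close> is a component of its own.
\<close>

lemma bar_transp_mult:
  assumes ij: "i \<in> {1..n}" "j \<in> {1..n}" "i \<noteq> j" and g: "\<gamma> \<in> brauer_graphs n"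
    and A: "A \<in> \<gamma>" "Pt i \<in> A" and B: "B \<in> \<gamma>" "Pt j \<in> B"
  defines "R \<equiv> A \<union> B - {Pt i, Pt j}"
  shows "bar_transp n i j \<cdot>\<^bsub>N\<^esub> basis \<gamma> =
    (if R = {} then scale N (basis (insert {Pt i, Pt j} (\<gamma> - {A, B})))
     else basis (insert {Pt i, Pt j} (insert R (\<gamma> - {A, B}))))"
proof -
  \<comment> \<open>The components are \<open>T\<close>, \<open>M\<close> and the sets \<open>pre e\<close> for the other edges \<open>e\<close> of \<open>\<gamma>\<close>: all upper
    vertices except \<open>Upper i\<close> and \<open>Upper j\<close> are attached to the middle vertex below them.\<close>
  define c where "c v = (case v of Upper i \<Rightarrow> Pt i | Middle i \<Rightarrow> Pt i | Lower i \<Rightarrow> Bar i)" for v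
  define pre where "pre e = {v \<in> glued_vertices n. c v \<in> e}" for e
  define T where "T = {Upper i, Upper j}"
  define M where "M = pre (A \<union> B) - T"
  define P where "P = insert T (insert M (pre ` (\<gamma> - {A, B})))"
  let ?b = "bar_transp_graph n i j"
  have b: "?b \<in> brauer_graphs n" by (rule bar_transp_graph_in[OF ij])
  have Ug: "\<Union> \<gamma> = vertices n" by (rule brauer_graphs_Union[OF g])
  have c_in: "c v \<in> vertices n" if "v \<in> glued_vertices n" for v
    using that by (cases v) (auto simp: c_def)
  have cl: "c (glue_lower v) = v" for v
    by (cases v) (auto simp: c_def)
  have gl: "glue_lower v \<in> glued_vertices n" if "v \<in> vertices n" for v
    using that by (cases v) auto
  have uniq: "e = f" if "e \<in> \<gamma>" "f \<in> \<gamma>" "v \<in> e" "v \<in> f" for e f v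
    using brauer_graphs_unique_edge[OF g that] .
  have T_pre: "v \<in> A \<union> B" if "v \<in> c ` T" for v
    using that A B by (auto simp: T_def c_def)
  have T_disj: "v \<notin> pre e" if "v \<in> T" "e \<in> \<gamma> - {A, B}" for v e
    using that uniq[of A e "Pt i"] uniq[of B e "Pt j"] A B by (auto simp: T_def c_def pre_def)
  have M_disj: "v \<notin> pre e" if "v \<in> M" "e \<in> \<gamma> - {A, B}" for v e
    using that uniq[of A e "c v"] uniq[of B e "c v"] A B by (auto simp: M_def pre_def)
  have TM_disj: "v \<notin> M" if "v \<in> T" for v
    using that by (simp add: M_def)
  have pre_disj: "e = f" if "e \<in> \<gamma>" "f \<in> \<gamma>" "v \<in> pre e" "v \<in> pre f" for e f v
    using that uniq[of e f "c v"] by (auto simp: pre_def)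
  have mid: "Middle i \<in> M" "Middle j \<in> M"
    using ij A B by (auto simp: M_def T_def pre_def c_def)
  have nempty: "pre e \<noteq> {}" if "e \<in> \<gamma>" for e
  proof -
    from that obtain v where "v \<in> e" "v \<in> vertices n"
      using brauer_graphs_nonempty[OF g] Ug by blast
    then show ?thesis
      using gl[of v] cl[of v] by (auto simp: pre_def)
  qed
  have pre_cases: "pre e \<in> P \<or> pre e \<subseteq> T \<union> M" if "e \<in> \<gamma>" for e
    using that by (auto simp: P_def M_def pre_def)
  have in_block: "\<exists>C\<in>P. X \<subseteq> C" if "e \<in> \<gamma>" "X \<subseteq> pre e - T" for e X
  proof (cases "pre e \<in> P")
    case False
    then have "X \<subseteq> M" using that pre_cases[of e] by blast
    then show ?thesis by (auto simp: P_def)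
  qed (use that in blast)
  have upper_edge: "glue_upper ` e \<in> upper_edges ?b" if "e \<in> ?b" for e
    using that by (auto simp: upper_edges_def)
  have b_cases: "e = {Pt i, Pt j} \<or> e = {Bar i, Bar j} \<or>
      (\<exists>m\<in>{1..n} - {i, j}. e = {Pt m, Bar m})" if "e \<in> ?b" for e
    using that by (auto simp: bar_transp_graph_def)
  have b_vert: "{Pt m, Bar m} \<in> ?b" if "m \<in> {1..n}" "m \<noteq> i" "m \<noteq> j" for m
    using that by (auto simp: bar_transp_graph_def)
  have attach: "(v, glue_lower (c v)) \<in> (adjacent ?b \<gamma>)\<^sup>*" if "v \<in> glued_vertices n - T" for v
  proof (cases v)
    case (Upper m)
    then have "m \<in> {1..n}" "m \<noteq> i" "m \<noteq> j" using that by (auto simp: T_def)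
    from upper_edge[OF b_vert[OF this]] show ?thesis
      using Upper by (auto simp: c_def adjacent_def)
  qed (auto simp: c_def)
  \<comment> \<open>The root can be chosen at a prescribed endpoint \<open>u\<close> of \<open>e\<close>; for \<open>A\<close> and \<open>B\<close> the endpoints
    \<open>Pt i\<close> and \<open>Pt j\<close> are needed, because the two roots are then adjacent.\<close>
  have within: "\<exists>r. \<forall>v\<in>pre e - T. (v, r) \<in> (adjacent ?b \<gamma>)\<^sup>*
      \<and> (u \<in> e \<longrightarrow> r = glue_lower u)" if e: "e \<in> \<gamma>" for e u
  proof -
    have *: "(v, glue_lower w) \<in> (adjacent ?b \<gamma>)\<^sup>*" if v: "v \<in> pre e - T" and w: "w \<in> e" for v w
    proof (cases "c v = w")
      case True
      then show ?thesis using attach[of v] v by (auto simp: pre_def)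
    next
      case False
      with v w e have "e = {c v, w}"
        by (auto simp: pre_def elim!: brauer_graphs_edge[OF g])
      with e have "glue_lower ` {c v, w} \<in> lower_edges \<gamma>"
        unfolding lower_edges_def by blast
      then have "(glue_lower (c v), glue_lower w) \<in> adjacent ?b \<gamma>"
        by (simp add: adjacent_def)
      then show ?thesis using attach[of v] v by (auto simp: pre_def intro: rtrancl_into_rtrancl)
    qed
    show ?thesis
    proof (cases "u \<in> e")
      case True
      then show ?thesis using * by blast
    next
      case False
      obtain w where "w \<in> e" using brauer_graphs_nonempty[OF g e] by blast
      then show ?thesis using * False by blast
    qed
  qed
  have "(Middle j, Middle i) \<in> adjacent ?b \<gamma>"
    using upper_edge[of "{Bar i, Bar j}"]
    by (auto simp: adjacent_def bar_transp_graph_def insert_commute)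
  then have M_conn: "(v, Middle i) \<in> (adjacent ?b \<gamma>)\<^sup>*" if "v \<in> M" for v
    using that within[OF A(1), of "Pt i"] within[OF B(1), of "Pt j"] A(2) B(2)
    by (auto simp: M_def pre_def intro: rtrancl_into_rtrancl)
  have T_edge: "(Upper j, Upper i) \<in> adjacent ?b \<gamma>"
    using upper_edge[of "{Pt i, Pt j}"]
    by (auto simp: adjacent_def bar_transp_graph_def insert_commute)
  have prod: "bar_transp n i j \<cdot>\<^bsub>N\<^esub> basis \<gamma> =
    scale (N ^ card {C \<in> P. terminal_vertices C = {}})
      (basis (terminal_vertices ` {C \<in> P. terminal_vertices C \<noteq> {}}))"
    unfolding bar_transp_def
  proof (rule basis_mult_eqI[OF b g])
    show "\<Union> P = glued_vertices n"
    proof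
      show "\<Union> P \<subseteq> glued_vertices n"
        using ij by (auto simp: P_def M_def T_def pre_def)
      show "glued_vertices n \<subseteq> \<Union> P"
      proof
        fix v assume v: "v \<in> glued_vertices n"
        then obtain e where "e \<in> \<gamma>" "v \<in> pre e"
          using c_in[OF v] Ug by (auto simp: pre_def)
        then show "v \<in> \<Union> P"
          using pre_cases[of e] by (auto simp: P_def)
      qed
    qed
    show "C = D" if "C \<in> P" "D \<in> P" "v \<in> C" "v \<in> D" for C D v
      using that T_disj[of v] M_disj[of v] TM_disj[of v] pre_disj[of _ _ v]
      unfolding P_def by blast
    show "{} \<notin> P"
      using mid nempty by (auto simp: P_def T_def)
    show "\<exists>C\<in>P. glue_upper ` e \<subseteq> C" if e: "e \<in> ?b" for e
      using b_cases[OF e]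
    proof (elim disjE bexE)
      assume "e = {Pt i, Pt j}"
      then show ?thesis by (auto simp: P_def T_def)
    next
      assume "e = {Bar i, Bar j}"
      then show ?thesis using mid by (auto simp: P_def)
    next
      fix m assume m: "m \<in> {1..n} - {i, j}" "e = {Pt m, Bar m}"
      then obtain f where f: "f \<in> \<gamma>" "Pt m \<in> f"
        using Ug by (metis DiffD1 Pt_in_vertices UnionE)
      then have "glue_upper ` e \<subseteq> pre f - T"
        using m by (auto simp: pre_def c_def T_def)
      with f(1) show ?thesis by (rule in_block)
    qed
    show "\<exists>C\<in>P. glue_lower ` e \<subseteq> C" if e: "e \<in> \<gamma>" for e
    proof -
      have "glue_lower v \<notin> T" for v by (cases v) (auto simp: T_def)
      moreover have "e \<subseteq> vertices n" using e Ug by blast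
      ultimately have "glue_lower ` e \<subseteq> pre e - T"
        using gl by (auto simp: pre_def cl)
      with e show ?thesis by (rule in_block)
    qed
    show "\<exists>r. \<forall>v\<in>C. (v, r) \<in> (adjacent ?b \<gamma>)\<^sup>*" if C: "C \<in> P" for C
    proof -
      consider "C = T" | "C = M" | e where "e \<in> \<gamma> - {A, B}" "C = pre e"
        using C by (auto simp: P_def)
      then show ?thesis
      proof cases
        case 1
        then show ?thesis using T_edge by (auto simp: T_def)
      next
        case 2
        then show ?thesis using M_conn by blast
      next
        case 3
        then have "C - T = C" using T_disj by blast
        moreover have "e \<in> \<gamma>" using 3 by blast
        ultimately show ?thesis using within[of e] 3(2) by fastforce
      qed
    qed
  qed
  have t_pre: "terminal_vertices (pre e) = e" if "e \<subseteq> vertices n" for e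
  proof (rule set_eqI)
    fix v show "v \<in> terminal_vertices (pre e) \<longleftrightarrow> v \<in> e"
      using that by (cases v) (auto simp: terminal_vertices_def pre_def c_def)
  qed
  have tT: "terminal_vertices T = {Pt i, Pt j}"
    by (auto simp: terminal_vertices_def T_def)
  have "terminal_vertices M = terminal_vertices (pre (A \<union> B)) - {Pt i, Pt j}"
    by (auto simp: terminal_vertices_def M_def T_def)
  moreover have "A \<union> B \<subseteq> vertices n" using A B Ug by blast
  ultimately have tM: "terminal_vertices M = R"
    by (simp add: t_pre R_def)
  have te: "terminal_vertices (pre e) = e" "e \<noteq> {}" if "e \<in> \<gamma> - {A, B}" for e
    using that t_pre[of e] Ug brauer_graphs_nonempty[OF g] by blast+
  have im: "terminal_vertices ` pre ` (\<gamma> - {A, B}) = \<gamma> - {A, B}"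
    using te by (force simp: image_image)
  have loops: "{C \<in> P. terminal_vertices C = {}} = (if R = {} then {M} else {})"
  proof -
    have "terminal_vertices C \<noteq> {}" if C: "C \<in> P" "C \<noteq> M" for C
    proof -
      from C consider "C = T" | e where "e \<in> \<gamma> - {A, B}" "C = pre e"
        by (auto simp: P_def)
      then show ?thesis using te tT by cases auto
    qed
    moreover have "M \<in> P" by (simp add: P_def)
    ultimately have "{C \<in> P. terminal_vertices C = {}} = {C. C = M \<and> terminal_vertices M = {}}"
      by blast
    then show ?thesis by (simp add: tM)
  qed
  have "terminal_vertices ` {C \<in> P. terminal_vertices C \<noteq> {}} = terminal_vertices ` P - {{}}"
    by auto
  also have "terminal_vertices ` P = insert {Pt i, Pt j} (insert R (\<gamma> - {A, B}))"
    by (simp add: P_def tT tM im)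
  also have "\<dots> - {{}} = (if R = {} then insert {Pt i, Pt j} (\<gamma> - {A, B})
      else insert {Pt i, Pt j} (insert R (\<gamma> - {A, B})))"
  proof -
    have "\<gamma> - {A, B} - {{}} = \<gamma> - {A, B}" using te(2) by blast
    then show ?thesis by (simp add: insert_Diff_if)
  qed
  finally show ?thesis
    unfolding prod loops by simp
qed


lemma bar_transp_commute_indices: "bar_transp n i j = bar_transp n j i"
  by (simp add: bar_transp_def bar_transp_graph_def insert_commute)

lemma transp_commute_indices: "transp n i j = transp n j i"
  by (simp add: transp_def transpose_commute)

lemma bar_transp_mult_join:
  assumes ij: "i \<in> {1..n}" "j \<in> {1..n}" "i \<noteq> j" and g: "\<gamma> \<in> brauer_graphs n"
    and a: "{Pt i, a} \<in> \<gamma>" and b: "{Pt j, b} \<in> \<gamma>" and "a \<noteq> Pt j"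
  shows "bar_transp n i j \<cdot>\<^bsub>N\<^esub> basis \<gamma> =
    basis (insert {Pt i, Pt j} (insert {a, b} (\<gamma> - {{Pt i, a}, {Pt j, b}})))"
proof -
  have "card {Pt i, a} = 2" "card {Pt j, b} = 2"
    using a b g by (auto simp: brauer_graphs_def)
  then have "a \<noteq> Pt i" "b \<noteq> Pt j" by auto
  moreover have "b \<noteq> Pt i"
    using brauer_graphs_unique_edge[OF g a b, of "Pt i"] ij \<open>a \<noteq> Pt j\<close> by (auto simp: doubleton_eq_iff)
  ultimately have "{Pt i, a} \<union> {Pt j, b} - {Pt i, Pt j} = {a, b}"
    using \<open>a \<noteq> Pt j\<close> by auto
  then show ?thesis
    using bar_transp_mult[OF ij g a _ b] by simp
qed

lemma bar_transp_square:
  assumes ij: "i \<in> {1..n}" "j \<in> {1..n}" "i \<noteq> j"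
  shows "bar_transp n i j \<cdot>\<^bsub>N\<^esub> bar_transp n i j = scale N (bar_transp n i j)"
proof -
  let ?g = "bar_transp_graph n i j"
  have e: "{Pt i, Pt j} \<in> ?g" by (simp add: bar_transp_graph_def)
  then have "insert {Pt i, Pt j} (?g - {{Pt i, Pt j}, {Pt i, Pt j}}) = ?g" by auto
  then show ?thesis
    using bar_transp_mult[OF ij bar_transp_graph_in[OF ij] e _ e]
    by (simp add: bar_transp_def)
qed

lemma bar_transp_mult_disjoint:
  assumes "i \<in> {1..n}" "j \<in> {1..n}" "i \<noteq> j" "k \<in> {1..n}" "l \<in> {1..n}" "k \<noteq> l"
    and "i \<noteq> k" "i \<noteq> l" "j \<noteq> k" "j \<noteq> l"
  shows "bar_transp n i j \<cdot>\<^bsub>N\<^esub> bar_transp n k l =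
    basis ({{Pt i, Pt j}, {Pt k, Pt l}, {Bar i, Bar j}, {Bar k, Bar l}} \<union>
      (\<lambda>m. {Pt m, Bar m}) ` ({1..n} - {i, j, k, l}))"
proof -
  let ?g = "bar_transp_graph n k l"
  define V where "V = (\<lambda>m. {Pt m, Bar m}) ` ({1..n} - {i, j, k, l})"
  have "{Pt i, Bar i} \<in> ?g" "{Pt j, Bar j} \<in> ?g"
    using assms by (auto simp: bar_transp_graph_def)
  note bar_transp_mult_join[OF assms(1-3) bar_transp_graph_in[OF assms(4-6)] this]
  moreover have "insert {Pt i, Pt j} (insert {Bar i, Bar j} (?g - {{Pt i, Bar i}, {Pt j, Bar j}})) =
    {{Pt i, Pt j}, {Pt k, Pt l}, {Bar i, Bar j}, {Bar k, Bar l}} \<union> V"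
  proof -
    have "{1..n} - {k, l} = insert i (insert j ({1..n} - {i, j, k, l}))" using assms by auto
    then have "?g = {{Pt k, Pt l}, {Bar k, Bar l}, {Pt i, Bar i}, {Pt j, Bar j}} \<union> V"
      by (simp add: bar_transp_graph_def V_def insert_commute)
    moreover have "V - {{Pt i, Bar i}, {Pt j, Bar j}} = V"
      by (auto simp: V_def doubleton_eq_iff)
    ultimately show ?thesis
      by (simp add: insert_Diff_if doubleton_eq_iff) (simp add: insert_commute)
  qed
  ultimately show ?thesis
    by (simp add: bar_transp_def V_def)
qed

lemma bar_transp_commute:
  assumes "i \<in> {1..n}" "j \<in> {1..n}" "i \<noteq> j" "k \<in> {1..n}" "l \<in> {1..n}" "k \<noteq> l"
    and "i \<noteq> k" "i \<noteq> l" "j \<noteq> k" "j \<noteq> l"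
  shows "bar_transp n i j \<cdot>\<^bsub>N\<^esub> bar_transp n k l = bar_transp n k l \<cdot>\<^bsub>N\<^esub> bar_transp n i j"
  using bar_transp_mult_disjoint[OF assms, of N] bar_transp_mult_disjoint[of k n l i j N] assms
  by (simp add: insert_commute)

lemma image_relabel_bar_transp_graph:
  "(`) (relabel f g) ` bar_transp_graph n k l =
    {{Pt (f k), Pt (f l)}, {Bar (g k), Bar (g l)}} \<union> (\<lambda>m. {Pt (f m), Bar (g m)}) ` ({1..n} - {k, l})"
  by (simp add: bar_transp_graph_def image_image)

lemma perm_mult_perm:
  assumes "s permutes {1..n}" "t permutes {1..n}"
  shows "perm n s \<cdot>\<^bsub>N\<^esub> perm n t = perm n (s \<circ> t)"
  using perm_mult_basis[OF assms(1) perm_graph_in[OF assms(2)]]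
  by (simp add: perm_def perm_graph_def image_image)

lemma perm_mult_bar_transp:
  assumes s: "s permutes {1..n}" and ij: "i \<in> {1..n}" "j \<in> {1..n}" "i \<noteq> j"
  shows "perm n s \<cdot>\<^bsub>N\<^esub> bar_transp n i j =
    basis ({{Pt (s i), Pt (s j)}, {Bar i, Bar j}} \<union> (\<lambda>m. {Pt (s m), Bar m}) ` ({1..n} - {i, j}))"
  unfolding bar_transp_def
  by (simp add: perm_mult_basis[OF s bar_transp_graph_in[OF ij]] image_relabel_bar_transp_graph)

lemma bar_transp_mult_perm:
  assumes s: "s permutes {1..n}" and ij: "i \<in> {1..n}" "j \<in> {1..n}" "i \<noteq> j"
  shows "bar_transp n i j \<cdot>\<^bsub>N\<^esub> perm n s =
    basis ({{Pt i, Pt j}, {Bar (inv s i), Bar (inv s j)}} \<union>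
      (\<lambda>m. {Pt m, Bar (inv s m)}) ` ({1..n} - {i, j}))"
  unfolding bar_transp_def
  by (simp add: basis_mult_perm[OF s bar_transp_graph_in[OF ij]] image_relabel_bar_transp_graph)

lemma perm_bar_transp_conj:
  assumes s: "s permutes {1..n}" and ij: "i \<in> {1..n}" "j \<in> {1..n}" "i \<noteq> j"
  shows "perm n s \<cdot>\<^bsub>N\<^esub> bar_transp n i j = bar_transp n (s i) (s j) \<cdot>\<^bsub>N\<^esub> perm n s"
proof -
  have inj: "inj s" by (rule permutes_inj[OF s])
  have sij: "s i \<in> {1..n}" "s j \<in> {1..n}" "s i \<noteq> s j"
    using ij permutes_in_image[OF s] inj by (auto dest: injD)
  have "{1..n} - {s i, s j} = s ` ({1..n} - {i, j})"
    using image_set_diff[OF inj, of "{1..n}" "{i, j}"] permutes_image[OF s] by simp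
  then show ?thesis
    using permutes_inverses[OF s]
    by (simp add: perm_mult_bar_transp[OF s ij] bar_transp_mult_perm[OF s sij] image_image)
qed

lemma perm_transp_conj:
  assumes s: "s permutes {1..n}" and ij: "i \<in> {1..n}" "j \<in> {1..n}"
  shows "perm n s \<cdot>\<^bsub>N\<^esub> transp n i j = transp n (s i) (s j) \<cdot>\<^bsub>N\<^esub> perm n s"
proof -
  have "s i \<in> {1..n}" "s j \<in> {1..n}"
    using ij permutes_in_image[OF s] by auto
  moreover have "s \<circ> transpose i j = transpose (s i) (s j) \<circ> s"
    using permutes_inj[OF s] by (auto simp: fun_eq_iff transpose_def dest: injD)
  ultimately show ?thesis
    using ij s by (simp add: transp_def perm_mult_perm permutes_swap_id)
qed

lemma bar_transp_mult_transp_self: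
  assumes ij: "i \<in> {1..n}" "j \<in> {1..n}" "i \<noteq> j"
  shows "bar_transp n i j \<cdot>\<^bsub>N\<^esub> transp n i j = bar_transp n i j"
proof -
  have p: "transpose i j permutes {1..n}" using ij by (simp add: permutes_swap_id)
  show ?thesis
    unfolding transp_def bar_transp_mult_perm[OF p ij]
    unfolding bar_transp_def bar_transp_graph_def
    by (rule arg_cong[where f = basis]) (auto simp: transpose_def insert_commute)
qed

lemma transp_mult_bar_transp_self:
  assumes ij: "i \<in> {1..n}" "j \<in> {1..n}" "i \<noteq> j"
  shows "transp n i j \<cdot>\<^bsub>N\<^esub> bar_transp n i j = bar_transp n i j"
  using perm_bar_transp_conj[of "transpose i j" n i j N] bar_transp_mult_transp_self[OF ij, of N] ij
  by (simp add: transp_def permutes_swap_id bar_transp_commute_indices[of n j i])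

text \<open>
  Both sides consist of the edges \<open>{Pt i, Pt j}\<close>, \<open>{Bar j, Bar l}\<close>, \<open>{Pt l, Bar i}\<close> and vertical
  edges. The mirror image below is the corresponding identity for the opposite product.
\<close>

lemma bar_transp_mult_overlap:
  assumes "i \<in> {1..n}" "j \<in> {1..n}" "l \<in> {1..n}" "i \<noteq> j" "i \<noteq> l" "j \<noteq> l"
  shows "bar_transp n i j \<cdot>\<^bsub>N\<^esub> bar_transp n j l = bar_transp n i j \<cdot>\<^bsub>N\<^esub> transp n i l"
proof -
  let ?g = "bar_transp_graph n j l"
  define V where "V = (\<lambda>m. {Pt m, Bar m}) ` ({1..n} - {i, j, l})"
  have p: "transpose i l permutes {1..n}" using assms by (simp add: permutes_swap_id)
  have "{Pt i, Bar i} \<in> ?g" "{Pt j, Pt l} \<in> ?g"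
    using assms by (auto simp: bar_transp_graph_def)
  then have "bar_transp n i j \<cdot>\<^bsub>N\<^esub> bar_transp n j l =
      basis (insert {Pt i, Pt j} (insert {Bar i, Pt l} (?g - {{Pt i, Bar i}, {Pt j, Pt l}})))"
    unfolding bar_transp_def[of n j l] using assms
    by (intro bar_transp_mult_join) (simp_all add: bar_transp_graph_in)
  also have "insert {Pt i, Pt j} (insert {Bar i, Pt l} (?g - {{Pt i, Bar i}, {Pt j, Pt l}})) =
      {{Pt i, Pt j}, {Bar j, Bar l}, {Pt l, Bar i}} \<union> V"
  proof -
    have "{1..n} - {j, l} = insert i ({1..n} - {i, j, l})" using assms by auto
    then have "?g = {{Pt j, Pt l}, {Bar j, Bar l}, {Pt i, Bar i}} \<union> V"
      by (simp add: bar_transp_graph_def V_def insert_commute)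
    moreover have "V - {{Pt i, Bar i}, {Pt j, Pt l}} = V"
      by (auto simp: V_def doubleton_eq_iff)
    ultimately show ?thesis
      by (simp add: insert_Diff_if doubleton_eq_iff) (simp add: insert_commute)
  qed
  also have "\<dots> = {{Pt i, Pt j}, {Bar l, Bar j}} \<union>
      (\<lambda>m. {Pt m, Bar (transpose i l m)}) ` ({1..n} - {i, j})"
  proof -
    have "{1..n} - {i, j} = insert l ({1..n} - {i, j, l})" using assms by auto
    moreover have "V = (\<lambda>m. {Pt m, Bar (transpose i l m)}) ` ({1..n} - {i, j, l})"
      unfolding V_def by (rule image_cong) (auto simp: transpose_apply_other)
    ultimately show ?thesis by (simp add: insert_commute)
  qed
  also have "basis \<dots> = bar_transp n i j \<cdot>\<^bsub>N\<^esub> transp n i l"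
    using assms by (simp add: transp_def bar_transp_mult_perm[OF p] transpose_apply_other)
  finally show ?thesis .
qed

lemma bar_transp_mult_overlap':
  assumes "i \<in> {1..n}" "j \<in> {1..n}" "l \<in> {1..n}" "i \<noteq> j" "i \<noteq> l" "j \<noteq> l"
  shows "bar_transp n j l \<cdot>\<^bsub>N\<^esub> bar_transp n i j = transp n i l \<cdot>\<^bsub>N\<^esub> bar_transp n i j"
proof -
  let ?g = "bar_transp_graph n i j"
  define V where "V = (\<lambda>m. {Pt m, Bar m}) ` ({1..n} - {i, j, l})"
  have p: "transpose i l permutes {1..n}" using assms by (simp add: permutes_swap_id)
  have "{Pt j, Pt i} \<in> ?g" "{Pt l, Bar l} \<in> ?g"
    using assms by (auto simp: bar_transp_graph_def)
  then have "bar_transp n j l \<cdot>\<^bsub>N\<^esub> bar_transp n i j =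
      basis (insert {Pt j, Pt l} (insert {Pt i, Bar l} (?g - {{Pt j, Pt i}, {Pt l, Bar l}})))"
    unfolding bar_transp_def[of n i j] using assms
    by (intro bar_transp_mult_join) (simp_all add: bar_transp_graph_in)
  also have "insert {Pt j, Pt l} (insert {Pt i, Bar l} (?g - {{Pt j, Pt i}, {Pt l, Bar l}})) =
      {{Pt l, Pt j}, {Bar i, Bar j}, {Pt i, Bar l}} \<union> V"
  proof -
    have "{1..n} - {i, j} = insert l ({1..n} - {i, j, l})" using assms by auto
    then have "?g = {{Pt j, Pt i}, {Bar i, Bar j}, {Pt l, Bar l}} \<union> V"
      by (simp add: bar_transp_graph_def V_def insert_commute)
    moreover have "V - {{Pt j, Pt i}, {Pt l, Bar l}} = V"
      by (auto simp: V_def doubleton_eq_iff)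
    ultimately show ?thesis
      by (simp add: insert_Diff_if doubleton_eq_iff) (simp add: insert_commute)
  qed
  also have "\<dots> = {{Pt l, Pt j}, {Bar i, Bar j}} \<union>
      (\<lambda>m. {Pt (transpose i l m), Bar m}) ` ({1..n} - {i, j})"
  proof -
    have "{1..n} - {i, j} = insert l ({1..n} - {i, j, l})" using assms by auto
    moreover have "V = (\<lambda>m. {Pt (transpose i l m), Bar m}) ` ({1..n} - {i, j, l})"
      unfolding V_def by (rule image_cong) (auto simp: transpose_apply_other)
    ultimately show ?thesis by (simp add: insert_commute)
  qed
  also have "basis \<dots> = transp n i l \<cdot>\<^bsub>N\<^esub> bar_transp n i j"
    using assms by (simp add: transp_def perm_mult_bar_transp[OF p] transpose_apply_other)
  finally show ?thesis .
qed

section \<open>Bilinearity\<close>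

lemma scale_zero_left [simp]: "scale 0 a = 0"
  by (rule poly_mapping_eqI) (simp add: lookup_scale)

lemma scale_add_left: "scale (c + d) a = scale c a + scale d a"
  by (rule poly_mapping_eqI) (simp add: lookup_scale lookup_add algebra_simps)

lemma scale_scale: "scale c (scale d a) = scale (c * d) a"
  by (rule poly_mapping_eqI) (simp add: lookup_scale)

lemma scale_sum: "scale c (sum f A) = (\<Sum>x\<in>A. scale c (f x))"
  by (rule poly_mapping_eqI) (simp add: lookup_scale lookup_sum sum_distrib_left)

text \<open>The sums over the supports may be taken over larger finite sets.\<close>

lemma brauer_mult_superset:
  assumes "finite K" "Poly_Mapping.keys a \<subseteq> K" "finite L" "Poly_Mapping.keys b \<subseteq> L"
  shows "a \<cdot>\<^bsub>N\<^esub> b = (\<Sum>\<gamma>\<in>K. \<Sum>\<gamma>'\<in>L.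
    scale (Poly_Mapping.lookup a \<gamma> * Poly_Mapping.lookup b \<gamma>')
      (scale (N ^ card (loops \<gamma> \<gamma>')) (basis (compose \<gamma> \<gamma>'))))"
proof -
  have "a \<cdot>\<^bsub>N\<^esub> b = (\<Sum>\<gamma>\<in>Poly_Mapping.keys a. \<Sum>\<gamma>'\<in>L.
      scale (Poly_Mapping.lookup a \<gamma> * Poly_Mapping.lookup b \<gamma>')
        (scale (N ^ card (loops \<gamma> \<gamma>')) (basis (compose \<gamma> \<gamma>'))))"
    unfolding brauer_mult_def using assms
    by (intro sum.cong refl sum.mono_neutral_left) (auto simp: in_keys_iff)
  also have "\<dots> = (\<Sum>\<gamma>\<in>K. \<Sum>\<gamma>'\<in>L.
      scale (Poly_Mapping.lookup a \<gamma> * Poly_Mapping.lookup b \<gamma>')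
        (scale (N ^ card (loops \<gamma> \<gamma>')) (basis (compose \<gamma> \<gamma>'))))"
    using assms by (intro sum.mono_neutral_left) (auto simp: in_keys_iff)
  finally show ?thesis .
qed

lemma brauer_mult_add_left: "(a + b) \<cdot>\<^bsub>N\<^esub> c = a \<cdot>\<^bsub>N\<^esub> c + b \<cdot>\<^bsub>N\<^esub> c"
proof -
  let ?K = "Poly_Mapping.keys a \<union> Poly_Mapping.keys b" and ?L = "Poly_Mapping.keys c"
  have K: "Poly_Mapping.keys (a + b) \<subseteq> ?K" "Poly_Mapping.keys a \<subseteq> ?K" "Poly_Mapping.keys b \<subseteq> ?K"
    "finite ?K"
    using Poly_Mapping.keys_add[of a b] by auto
  show ?thesis
    unfolding K(1-3)[THEN brauer_mult_superset[OF K(4) _ finite_keys[of c] subset_refl]]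
    by (simp add: lookup_add distrib_right scale_add_left sum.distrib)
qed

lemma brauer_mult_add_right: "a \<cdot>\<^bsub>N\<^esub> (b + c) = a \<cdot>\<^bsub>N\<^esub> b + a \<cdot>\<^bsub>N\<^esub> c"
proof -
  let ?L = "Poly_Mapping.keys b \<union> Poly_Mapping.keys c"
  have L: "Poly_Mapping.keys (b + c) \<subseteq> ?L" "Poly_Mapping.keys b \<subseteq> ?L" "Poly_Mapping.keys c \<subseteq> ?L"
    "finite ?L"
    using Poly_Mapping.keys_add[of b c] by auto
  show ?thesis
    unfolding L(1-3)[THEN brauer_mult_superset[OF finite_keys[of a] subset_refl L(4)]]
    by (simp add: lookup_add distrib_left scale_add_left sum.distrib)
qed

lemma keys_scale_subset: "Poly_Mapping.keys (scale c a) \<subseteq> Poly_Mapping.keys a"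
  by (auto simp: in_keys_iff lookup_scale)

lemma brauer_mult_scale_left: "scale r a \<cdot>\<^bsub>N\<^esub> b = scale r (a \<cdot>\<^bsub>N\<^esub> b)"
  unfolding brauer_mult_superset[OF finite_keys[of a] keys_scale_subset[of r a] finite_keys[of b] subset_refl]
    brauer_mult_def[of a]
  by (simp add: scale_sum scale_scale lookup_scale mult.assoc)

lemma brauer_mult_scale_right: "a \<cdot>\<^bsub>N\<^esub> scale r b = scale r (a \<cdot>\<^bsub>N\<^esub> b)"
  unfolding brauer_mult_superset[OF finite_keys[of a] subset_refl finite_keys[of b] keys_scale_subset[of r b]]
    brauer_mult_def[of a N b]
  by (simp add: scale_sum scale_scale lookup_scale ac_simps)

interpretation brauer_mult_left: additive "\<lambda>a. a \<cdot>\<^bsub>N\<^esub> b" for N b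
  by standard (rule brauer_mult_add_left)

interpretation brauer_mult_right: additive "\<lambda>b. a \<cdot>\<^bsub>N\<^esub> b" for N a
  by standard (rule brauer_mult_add_right)

lemma relabel_id [simp]: "relabel id id = id"
  by (rule ext, rename_tac v, case_tac v) auto

lemma brauer_one_mult: "\<gamma> \<in> brauer_graphs n \<Longrightarrow> brauer_one n \<cdot>\<^bsub>N\<^esub> basis \<gamma> = basis \<gamma>"
  by (simp add: brauer_one_def perm_mult_basis permutes_id)

lemma mult_brauer_one: "\<gamma> \<in> brauer_graphs n \<Longrightarrow> basis \<gamma> \<cdot>\<^bsub>N\<^esub> brauer_one n = basis \<gamma>"
  by (simp add: brauer_one_def basis_mult_perm permutes_id inv_id)

section \<open>Relations between the generators\<close>

text \<open>The summands \<open>t(i,j) - e(i,j)\<close> of the Jucys--Murphy elements \<^const>\<open>x_elt\<close>.\<close>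

definition jm_term :: "nat \<Rightarrow> nat \<Rightarrow> nat \<Rightarrow> brauer" where
  "jm_term n i j = transp n i j - bar_transp n i j"

lemma jm_term_commute_indices: "jm_term n i j = jm_term n j i"
  by (simp add: jm_term_def transp_commute_indices[of n i] bar_transp_commute_indices[of n i])

lemma perm_jm_term_conj:
  assumes "s permutes {1..n}" "i \<in> {1..n}" "j \<in> {1..n}" "i \<noteq> j"
  shows "perm n s \<cdot>\<^bsub>N\<^esub> jm_term n i j = jm_term n (s i) (s j) \<cdot>\<^bsub>N\<^esub> perm n s"
  using assms
  by (simp add: jm_term_def brauer_mult_left.diff brauer_mult_right.diff
      perm_transp_conj perm_bar_transp_conj)

lemma bar_transp_jm_term_commute:
  assumes "i \<in> {1..n}" "j \<in> {1..n}" "i \<noteq> j" "k \<in> {1..n}" "l \<in> {1..n}" "k \<noteq> l"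
    and "i \<noteq> k" "i \<noteq> l" "j \<noteq> k" "j \<noteq> l"
  shows "bar_transp n i j \<cdot>\<^bsub>N\<^esub> jm_term n k l = jm_term n k l \<cdot>\<^bsub>N\<^esub> bar_transp n i j"
proof -
  have "transp n k l \<cdot>\<^bsub>N\<^esub> bar_transp n i j = bar_transp n i j \<cdot>\<^bsub>N\<^esub> transp n k l"
    using perm_bar_transp_conj[of "transpose k l" n i j N] assms
    by (simp add: transp_def permutes_swap_id transpose_apply_other)
  then show ?thesis
    unfolding jm_term_def brauer_mult_left.diff brauer_mult_right.diff bar_transp_commute[OF assms]
    by (simp only:)
qed

text \<open>
  By \<open>bar_transp_mult_overlap\<close>, for \<open>i, j\<close> in both orders, the bar term of each summand cancels
  the transposition of the other.
\<close>

lemma bar_transp_mult_jm_terms: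
  assumes "i \<in> {1..n}" "j \<in> {1..n}" "l \<in> {1..n}" "i \<noteq> j" "i \<noteq> l" "j \<noteq> l"
  shows "bar_transp n i j \<cdot>\<^bsub>N\<^esub> (jm_term n i l + jm_term n j l) = 0"
  using bar_transp_mult_overlap[OF assms, of N] bar_transp_mult_overlap[of j n i l N] assms
  by (simp add: jm_term_def brauer_mult_right.diff brauer_mult_right.add
      bar_transp_commute_indices[of n j i])

lemma jm_terms_mult_bar_transp:
  assumes "i \<in> {1..n}" "j \<in> {1..n}" "l \<in> {1..n}" "i \<noteq> j" "i \<noteq> l" "j \<noteq> l"
  shows "(jm_term n i l + jm_term n j l) \<cdot>\<^bsub>N\<^esub> bar_transp n i j = 0"
  using bar_transp_mult_overlap'[OF assms, of N] bar_transp_mult_overlap'[of j n i l N] assms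
  by (simp add: jm_term_def brauer_mult_left.diff brauer_mult_left.add
      bar_transp_commute_indices[of n j i])

lemma x_elt_eq:
  "x_elt n N k = scale ((N - 1) / 2) (brauer_one n) + (\<Sum>l\<in>{1..<k}. jm_term n k l)"
  by (simp add: x_elt_def jm_term_def)

lemma x_elt_Suc:
  assumes "k \<ge> 1"
  shows "x_elt n N (k + 1) =
    scale ((N - 1) / 2) (brauer_one n) + (\<Sum>l\<in>{1..<k}. jm_term n (k + 1) l) + jm_term n (k + 1) k"
proof -
  have "{1..<k + 1} = insert k {1..<k}" using assms by auto
  then show ?thesis by (simp add: x_elt_eq add.assoc add.commute)
qed

lemma perm_mult_x_elt:
  assumes s: "s permutes {1..n}" and l: "l \<in> {1..n}"
  shows "perm n s \<cdot>\<^bsub>N\<^esub> x_elt n N l = scale ((N - 1) / 2) (perm n s) +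
    (\<Sum>m\<in>{1..<l}. jm_term n (s l) (s m) \<cdot>\<^bsub>N\<^esub> perm n s)"
proof -
  have "perm n s \<cdot>\<^bsub>N\<^esub> brauer_one n = perm n s"
    unfolding perm_def by (rule mult_brauer_one[OF perm_graph_in[OF s]])
  moreover have "perm n s \<cdot>\<^bsub>N\<^esub> jm_term n l m = jm_term n (s l) (s m) \<cdot>\<^bsub>N\<^esub> perm n s"
    if "m \<in> {1..<l}" for m
    using perm_jm_term_conj[OF s l, of m N] l that by auto
  ultimately show ?thesis
    by (simp add: x_elt_eq brauer_mult_right.add brauer_mult_right.sum brauer_mult_scale_right)
qed

lemma x_elt_mult_perm:
  assumes s: "s permutes {1..n}"
  shows "x_elt n N l \<cdot>\<^bsub>N\<^esub> perm n s = scale ((N - 1) / 2) (perm n s) +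
    (\<Sum>m\<in>{1..<l}. jm_term n l m \<cdot>\<^bsub>N\<^esub> perm n s)"
proof -
  have "brauer_one n \<cdot>\<^bsub>N\<^esub> perm n s = perm n s"
    unfolding perm_def by (rule brauer_one_mult[OF perm_graph_in[OF s]])
  then show ?thesis
    by (simp add: x_elt_eq brauer_mult_left.add brauer_mult_left.sum brauer_mult_scale_left)
qed

lemma bar_transp_mult_x_elt:
  assumes "i \<in> {1..n}" "j \<in> {1..n}" "i \<noteq> j"
  shows "bar_transp n i j \<cdot>\<^bsub>N\<^esub> x_elt n N l = scale ((N - 1) / 2) (bar_transp n i j) +
    bar_transp n i j \<cdot>\<^bsub>N\<^esub> (\<Sum>m\<in>{1..<l}. jm_term n l m)"
proof -
  have "bar_transp n i j \<cdot>\<^bsub>N\<^esub> brauer_one n = bar_transp n i j"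
    unfolding bar_transp_def by (rule mult_brauer_one[OF bar_transp_graph_in[OF assms]])
  then show ?thesis
    by (simp add: x_elt_eq brauer_mult_right.add brauer_mult_scale_right)
qed

lemma x_elt_mult_bar_transp:
  assumes "i \<in> {1..n}" "j \<in> {1..n}" "i \<noteq> j"
  shows "x_elt n N l \<cdot>\<^bsub>N\<^esub> bar_transp n i j = scale ((N - 1) / 2) (bar_transp n i j) +
    (\<Sum>m\<in>{1..<l}. jm_term n l m) \<cdot>\<^bsub>N\<^esub> bar_transp n i j"
proof -
  have "brauer_one n \<cdot>\<^bsub>N\<^esub> bar_transp n i j = bar_transp n i j"
    unfolding bar_transp_def by (rule brauer_one_mult[OF bar_transp_graph_in[OF assms]])
  then show ?thesis
    by (simp add: x_elt_eq brauer_mult_left.add brauer_mult_scale_left)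
qed

lemma s_gen_x_elt_commute:
  assumes k: "k \<in> {1..n - 1}" and l: "l \<in> {1..n}" "l \<noteq> k" "l \<noteq> k + 1"
  shows "s_gen n k \<cdot>\<^bsub>N\<^esub> x_elt n N l = x_elt n N l \<cdot>\<^bsub>N\<^esub> s_gen n k"
proof -
  define s where "s = transpose k (k + 1)"
  have s: "s permutes {1..n}" using k by (auto simp: s_def intro: permutes_swap_id)
  have sl: "s l = l" using l by (simp add: s_def transpose_apply_other)
  \<comment> \<open>Since \<open>l\<close> is neither \<open>k\<close> nor \<open>k + 1\<close>, the range of summation contains both or none of them.\<close>
  have "bij_betw s {1..<l} {1..<l}"
  proof (cases "l < k")
    case True
    then have "s m = m" if "m \<in> {1..<l}" for m using that by (simp add: s_def transpose_def)
    then show ?thesis by (subst bij_betw_cong[where g = id]) auto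
  next
    case False
    then have "s permutes {1..<l}" using k l by (auto simp: s_def intro: permutes_swap_id)
    then show ?thesis by (rule permutes_imp_bij)
  qed
  then have "(\<Sum>m\<in>{1..<l}. jm_term n l (s m) \<cdot>\<^bsub>N\<^esub> perm n s) = (\<Sum>m\<in>{1..<l}. jm_term n l m \<cdot>\<^bsub>N\<^esub> perm n s)"
    by (rule sum.reindex_bij_betw)
  then have "perm n s \<cdot>\<^bsub>N\<^esub> x_elt n N l = x_elt n N l \<cdot>\<^bsub>N\<^esub> perm n s"
    by (simp add: perm_mult_x_elt[OF s l(1)] x_elt_mult_perm[OF s] sl)
  then show ?thesis by (simp add: s_gen_def transp_def s_def)
qed

lemma sbar_gen_x_elt_commute:
  assumes k: "k \<in> {1..n - 1}" and l: "l \<in> {1..n}" "l \<noteq> k" "l \<noteq> k + 1"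
  shows "sbar_gen n k \<cdot>\<^bsub>N\<^esub> x_elt n N l = x_elt n N l \<cdot>\<^bsub>N\<^esub> sbar_gen n k"
proof -
  let ?b = "bar_transp n k (k + 1)"
  define S where "S = (\<Sum>m\<in>{1..<l} - {k, k + 1}. jm_term n l m)"
  define Q where "Q = jm_term n k l + jm_term n (k + 1) l"
  have kn: "k \<in> {1..n}" "k + 1 \<in> {1..n}" "k \<noteq> k + 1" using k by auto
  have "?b \<cdot>\<^bsub>N\<^esub> jm_term n l m = jm_term n l m \<cdot>\<^bsub>N\<^esub> ?b" if "m \<in> {1..<l} - {k, k + 1}" for m
    using that l by (intro bar_transp_jm_term_commute[OF kn]) auto
  then have S: "?b \<cdot>\<^bsub>N\<^esub> S = S \<cdot>\<^bsub>N\<^esub> ?b"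
    by (simp add: S_def brauer_mult_left.sum brauer_mult_right.sum)
  have "?b \<cdot>\<^bsub>N\<^esub> (\<Sum>m\<in>{1..<l}. jm_term n l m) = (\<Sum>m\<in>{1..<l}. jm_term n l m) \<cdot>\<^bsub>N\<^esub> ?b"
  proof (cases "l < k")
    case True
    then have "{1..<l} - {k, k + 1} = {1..<l}" by auto
    then show ?thesis using S by (simp only: S_def)
  next
    case False
    then have "{k, k + 1} \<subseteq> {1..<l}" using k l by auto
    then have "(\<Sum>m\<in>{1..<l}. jm_term n l m) = S + (\<Sum>m\<in>{k, k + 1}. jm_term n l m)"
      unfolding S_def by (intro sum.subset_diff) auto
    also have "(\<Sum>m\<in>{k, k + 1}. jm_term n l m) = Q"
      by (simp add: Q_def jm_term_commute_indices[of n l])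
    finally have eq: "(\<Sum>m\<in>{1..<l}. jm_term n l m) = S + Q" .
    have "?b \<cdot>\<^bsub>N\<^esub> Q = 0" "Q \<cdot>\<^bsub>N\<^esub> ?b = 0"
      using kn l unfolding Q_def
      by (intro bar_transp_mult_jm_terms jm_terms_mult_bar_transp; simp)+
    then show ?thesis
      unfolding eq by (simp add: brauer_mult_add_left brauer_mult_add_right S[simplified])
  qed
  then show ?thesis
    by (simp only: sbar_gen_def bar_transp_mult_x_elt[OF kn] x_elt_mult_bar_transp[OF kn])
qed

lemma s_gen_x_elt_exchange:
  assumes k: "k \<in> {1..n - 1}"
  shows "s_gen n k \<cdot>\<^bsub>N\<^esub> x_elt n N k - x_elt n N (k + 1) \<cdot>\<^bsub>N\<^esub> s_gen n k
      = sbar_gen n k - brauer_one n" (is ?A)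
    and "s_gen n k \<cdot>\<^bsub>N\<^esub> x_elt n N (k + 1) - x_elt n N k \<cdot>\<^bsub>N\<^esub> s_gen n k
      = brauer_one n - sbar_gen n k" (is ?B)
proof -
  define s where "s = transpose k (k + 1)"
  have kn: "k \<in> {1..n}" "k + 1 \<in> {1..n}" "k \<noteq> k + 1" using k by auto
  have s: "s permutes {1..n}" using kn by (simp add: s_def permutes_swap_id)
  have g: "s_gen n k = perm n s" by (simp add: s_gen_def transp_def s_def)
  have sk: "s k = k + 1" "s (k + 1) = k" by (simp_all add: s_def)
  have sm: "s m = m" if "m \<in> {1..<k}" for m using that by (simp add: s_def transpose_def)
  have ss: "perm n s \<cdot>\<^bsub>N\<^esub> perm n s = brauer_one n"
    using perm_mult_perm[OF s s] by (simp add: brauer_one_def s_def)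
  have jm: "jm_term n (k + 1) k \<cdot>\<^bsub>N\<^esub> perm n s = brauer_one n - sbar_gen n k"
    using bar_transp_mult_transp_self[OF kn, of N] ss
    unfolding jm_term_commute_indices[of n "k + 1" k]
    unfolding jm_term_def brauer_mult_left.diff
    by (simp add: sbar_gen_def transp_def s_def)
  have range: "{1..<k + 1} = insert k {1..<k}" using kn by auto
  have sum: "(\<Sum>m\<in>{1..<k + 1}. f m) = (\<Sum>m\<in>{1..<k}. f m) + f k" for f :: "nat \<Rightarrow> brauer"
    unfolding range by (simp add: add.commute)
  show ?A
    unfolding g perm_mult_x_elt[OF s kn(1)] x_elt_mult_perm[OF s] sum jm
    by (simp add: sk sm)
  have "jm_term n k (k + 1) \<cdot>\<^bsub>N\<^esub> perm n s = brauer_one n - sbar_gen n k"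
    using jm by (simp add: jm_term_commute_indices[of n k])
  then show ?B
    unfolding g perm_mult_x_elt[OF s kn(2)] x_elt_mult_perm[OF s] sum sk
    by (simp add: sm)
qed

lemma scale_cancel: "scale ((N - 1) / 2) a + scale ((N - 1) / 2) a + (a - scale N a) = 0"
  by (rule poly_mapping_eqI) (simp add: lookup_scale lookup_add lookup_minus field_simps)

lemma sbar_gen_x_elt_annihilate:
  assumes k: "k \<in> {1..n - 1}"
  shows "sbar_gen n k \<cdot>\<^bsub>N\<^esub> (x_elt n N k + x_elt n N (k + 1)) = 0" (is ?A)
    and "(x_elt n N k + x_elt n N (k + 1)) \<cdot>\<^bsub>N\<^esub> sbar_gen n k = 0" (is ?B)
proof -
  let ?b = "bar_transp n k (k + 1)"
  have kn: "k \<in> {1..n}" "k + 1 \<in> {1..n}" "k \<noteq> k + 1" using k by auto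
  define S where "S = (\<Sum>m\<in>{1..<k}. jm_term n k m + jm_term n (k + 1) m)"
  have one: "?b \<cdot>\<^bsub>N\<^esub> brauer_one n = ?b" "brauer_one n \<cdot>\<^bsub>N\<^esub> ?b = ?b"
    unfolding bar_transp_def
    using bar_transp_graph_in[OF kn] by (rule mult_brauer_one brauer_one_mult)+
  have x: "x_elt n N k + x_elt n N (k + 1) = scale ((N - 1) / 2) (brauer_one n) +
      scale ((N - 1) / 2) (brauer_one n) + jm_term n k (k + 1) + S"
    using x_elt_Suc[of k n N] kn
    by (simp add: x_elt_eq[of n N k] S_def sum.distrib jm_term_commute_indices[of n "Suc k" k])
  have "?b \<cdot>\<^bsub>N\<^esub> (jm_term n k m + jm_term n (k + 1) m) = 0"
    "(jm_term n k m + jm_term n (k + 1) m) \<cdot>\<^bsub>N\<^esub> ?b = 0" if "m \<in> {1..<k}" for m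
    using kn that by (intro bar_transp_mult_jm_terms jm_terms_mult_bar_transp; simp)+
  then have S: "?b \<cdot>\<^bsub>N\<^esub> S = 0" "S \<cdot>\<^bsub>N\<^esub> ?b = 0"
    unfolding S_def brauer_mult_left.sum brauer_mult_right.sum by simp_all
  have jm: "?b \<cdot>\<^bsub>N\<^esub> jm_term n k (k + 1) = ?b - scale N ?b"
    "jm_term n k (k + 1) \<cdot>\<^bsub>N\<^esub> ?b = ?b - scale N ?b"
    unfolding jm_term_def brauer_mult_left.diff brauer_mult_right.diff
      bar_transp_mult_transp_self[OF kn] transp_mult_bar_transp_self[OF kn] bar_transp_square[OF kn]
    by (rule refl)+
  show ?A
    unfolding x sbar_gen_def brauer_mult_right.add brauer_mult_scale_right one jm S add_0_right
    by (rule scale_cancel)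
  show ?B
    unfolding x sbar_gen_def brauer_mult_left.add brauer_mult_scale_left one jm S add_0_right
    by (rule scale_cancel)
qed

theorem proposition2p3:
  fixes n :: nat and N :: complex
  assumes "n \<ge> 1"
  shows "\<forall>k\<in>{1..n - 1}.
      (\<forall>l\<in>{1..n}. l \<noteq> k \<and> l \<noteq> k + 1 \<longrightarrow>
         s_gen n k \<cdot>\<^bsub>N\<^esub> x_elt n N l = x_elt n N l \<cdot>\<^bsub>N\<^esub> s_gen n k \<and>
         sbar_gen n k \<cdot>\<^bsub>N\<^esub> x_elt n N l = x_elt n N l \<cdot>\<^bsub>N\<^esub> sbar_gen n k) \<and>
      s_gen n k \<cdot>\<^bsub>N\<^esub> x_elt n N k - x_elt n N (k + 1) \<cdot>\<^bsub>N\<^esub> s_gen n k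
        = sbar_gen n k - brauer_one n \<and>
      s_gen n k \<cdot>\<^bsub>N\<^esub> x_elt n N (k + 1) - x_elt n N k \<cdot>\<^bsub>N\<^esub> s_gen n k
        = brauer_one n - sbar_gen n k \<and>
      sbar_gen n k \<cdot>\<^bsub>N\<^esub> (x_elt n N k + x_elt n N (k + 1)) = 0 \<and>
      (x_elt n N k + x_elt n N (k + 1)) \<cdot>\<^bsub>N\<^esub> sbar_gen n k = 0"
proof
  fix k assume k: "k \<in> {1..n - 1}"
  show "(\<forall>l\<in>{1..n}. l \<noteq> k \<and> l \<noteq> k + 1 \<longrightarrow>
         s_gen n k \<cdot>\<^bsub>N\<^esub> x_elt n N l = x_elt n N l \<cdot>\<^bsub>N\<^esub> s_gen n k \<and>
         sbar_gen n k \<cdot>\<^bsub>N\<^esub> x_elt n N l = x_elt n N l \<cdot>\<^bsub>N\<^esub> sbar_gen n k) \<and>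
      s_gen n k \<cdot>\<^bsub>N\<^esub> x_elt n N k - x_elt n N (k + 1) \<cdot>\<^bsub>N\<^esub> s_gen n k
        = sbar_gen n k - brauer_one n \<and>
      s_gen n k \<cdot>\<^bsub>N\<^esub> x_elt n N (k + 1) - x_elt n N k \<cdot>\<^bsub>N\<^esub> s_gen n k
        = brauer_one n - sbar_gen n k \<and>
      sbar_gen n k \<cdot>\<^bsub>N\<^esub> (x_elt n N k + x_elt n N (k + 1)) = 0 \<and>
      (x_elt n N k + x_elt n N (k + 1)) \<cdot>\<^bsub>N\<^esub> sbar_gen n k = 0"
    by (intro conjI ballI impI s_gen_x_elt_exchange[OF k] sbar_gen_x_elt_annihilate[OF k])
      (auto intro: s_gen_x_elt_commute[OF k] sbar_gen_x_elt_commute[OF k] simp del: One_nat_def)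
qed

end
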